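(* Let $D$ be a positive integer and $\Gamma\subseteq\mathbb{R}^D$ orthosymmetric, compact and convex. If a pair of positive integers $(m,n)$ lies in the LFHT feasible region of $\Gamma$ at scale $\epsilon$, then $$m\ge\frac1{\epsilon^2},\qquad n\ge\frac{\sqrt{n_{\mathrm{est}}(\Gamma,\sqrt2\epsilon)}}{8\epsilon\sqrt{\log(4D)}},\qquad mn\ge\frac{n_{\mathrm{est}}(\Gamma,\sqrt2\epsilon)-1}{3072\,\epsilon^2\log(4D)}.$$
   Context: Orthosymmetric: closed under flipping signs of any coordinates. $n_{\mathrm{est}}(\Gamma,\epsilon)$: smallest $n$ such that from $n$ i.i.d. samples of $\mathcal N(\boldsymbol\theta,I_D)$ some estimator has $\sup_{\boldsymbol\theta\in\Gamma}\mathbb E\|\hat{\boldsymbol\theta}-\boldsymbol\theta\|_2^2\le\epsilon^2$. Likelihood-free hypothesis testing (LFHT): unknown $\boldsymbol\theta^1,\boldsymbol\theta^2,\boldsymbol\theta\in\Gamma$ with $\|\boldsymbol\theta^1-\boldsymbol\theta^2\|_2\ge\epsilon$; one observes $\mathbf X$ ($n$ i.i.d. samples of $\mathcal N(\boldsymbol\theta^1,I_D)$), $\mathbf Y$ ($n$ i.i.d. samples of $\mathcal N(\boldsymbol\theta^2,I_D)$) and $\mathbf Z$ ($m$ i.i.d. samples of $\mathcal N(\boldsymbol\theta,I_D)$), all independent, and tests $H_0:\boldsymbol\theta=\boldsymbol\theta^1$ vs $H_1:\boldsymbol\theta=\boldsymbol\theta^2$ by $\psi(\mathbf X,\mathbf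 Y,\mathbf Z)\in\{0,1\}$. $(m,n)$ lies in the feasible region at scale $\epsilon$ if some $\psi$ satisfies $\max_{i\in\{0,1\}}\sup_{H_i}\mathbb P(\psi\ne i)\le1/4$, where the supremum over $H_i$ ranges over all $\boldsymbol\theta^1,\boldsymbol\theta^2\in\Gamma$ with $\|\boldsymbol\theta^1-\boldsymbol\theta^2\|_2\ge\epsilon$ and $\boldsymbol\theta=\boldsymbol\theta^{i+1}$.
   Formalization: The formal theorem also assumes that ε > 0 and that Γ contains two points at distance at least ε; otherwise every (m,n) is vacuously feasible and m ≥ 1/ε² can fail (e.g. Γ = {0}, ε = 1/2, m = n = 1). *)

theory Defs
  imports "HOL-Probability.Probability"
begin

definition gauss :: "real^'d \<Rightarrow> (real^'d) measure" where
  "gauss \<theta> = density lborel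
     (\<lambda>x. ennreal ((2 * pi) powr (- real CARD('d) / 2) * exp (- (norm (x - \<theta>))\<^sup>2 / 2)))"

definition samples :: "nat \<Rightarrow> real^'d \<Rightarrow> (nat \<Rightarrow> real^'d) measure" where
  "samples n \<theta> = PiM {..<n} (\<lambda>_. gauss \<theta>)"

text \<open>Underlying measurable space of n samples (same sigma-algebra as samples n theta).\<close>
definition sample_space :: "nat \<Rightarrow> (nat \<Rightarrow> real^'d) measure" where
  "sample_space n = PiM {..<n} (\<lambda>_. lborel)"

definition orthosymmetric :: "(real^'d) set \<Rightarrow> bool" where
  "orthosymmetric \<Gamma> \<longleftrightarrow>
     (\<forall>x\<in>\<Gamma>. \<forall>S. (\<chi> i. if i \<in> S then - (x $ i) else x $ i) \<in> \<Gamma>)"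

definition n_est :: "(real^'d) set \<Rightarrow> real \<Rightarrow> nat" where
  "n_est \<Gamma> \<epsilon> = (LEAST n. \<exists>est \<in> borel_measurable (sample_space n).
      \<forall>\<theta>\<in>\<Gamma>. (\<integral>\<^sup>+ X. ennreal ((norm (est X - \<theta>))\<^sup>2) \<partial>samples n \<theta>) \<le> ennreal (\<epsilon>\<^sup>2))"

text \<open>Data (X,Y,Z) arranged as ((X,Y),Z); a test returns True for deciding H_1.\<close>
definition lfht_data :: "nat \<Rightarrow> nat \<Rightarrow> real^'d \<Rightarrow> real^'d \<Rightarrow> real^'d \<Rightarrow>
    (((nat \<Rightarrow> real^'d) \<times> (nat \<Rightarrow> real^'d)) \<times> (nat \<Rightarrow> real^'d)) measure" where
  "lfht_data m n \<theta>1 \<theta>2 \<theta> = (samples n \<theta>1 \<Otimes>\<^sub>M samples n \<theta>2) \<Otimes>\<^sub>M samples m \<theta>"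

definition lfht_feasible :: "(real^'d) set \<Rightarrow> real \<Rightarrow> nat \<Rightarrow> nat \<Rightarrow> bool" where
  "lfht_feasible \<Gamma> \<epsilon> m n \<longleftrightarrow>
    (\<exists>\<psi> \<in> measurable ((sample_space n \<Otimes>\<^sub>M sample_space n) \<Otimes>\<^sub>M sample_space m)
                      (count_space (UNIV :: bool set)).
      \<forall>\<theta>1\<in>\<Gamma>. \<forall>\<theta>2\<in>\<Gamma>. dist \<theta>1 \<theta>2 \<ge> \<epsilon> \<longrightarrow>
        measure (lfht_data m n \<theta>1 \<theta>2 \<theta>1) {w \<in> space (lfht_data m n \<theta>1 \<theta>2 \<theta>1). \<psi> w \<noteq> False} \<le> 1/4 \<and>
        measure (lfht_data m n \<theta>1 \<theta>2 \<theta>2) {w \<in> space (lfht_data m n \<theta>1 \<theta>2 \<theta>2). \<psi> w \<noteq> True} \<le> 1/4)"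

end

theory Submission
  imports Defs
begin

text \<open>
  All laws of the data are absolutely continuous with respect to the law with zero means, and the
  likelihood ratios are exponentials of linear functions of the three sample sums, so every integral
  needed is a Gaussian moment generating function.

  Two-point tests (means x and -x with 2|x| = \<epsilon>) give m \<epsilon>^2 \<ge> 1 and n \<epsilon>^2 \<ge> 1/2 through the Hellinger
  affinity. Next let k = n_est - 1 and L = ln (4 D). Soft thresholding at level sqrt (2 L / k) of the mean
  of k samples has risk at most 3/2 (sum of min (\<theta>_i^2, 8 L / k)) + 3 / (2 k L). This must exceed 2 \<epsilon>^2
  somewhere on \<Gamma>, and as \<Gamma> is solid it therefore contains, unless k L \<epsilon>^2 < 3, a vector x with |x| = \<epsilon>
  and all x_i^2 \<le> 8 L / k, whence the sum of x_i^4 is at most 8 L \<epsilon>^2 / k. Put independent uniform signs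
  on the coordinates of x.
  With \<theta> = 0 and one of \<theta>1, \<theta>2 equal to 0, the chi-square distance of the mixtures from the null law is
  controlled by n^2 (sum of x_i^4). With \<theta>1 = -\<theta>2 the law of Z is the same under both hypotheses, and the
  chi-square distance from the product of the marginal laws of (X, Y) and Z is controlled by
  m n (sum of x_i^4).
\<close>

subsection \<open>Likelihood ratios and Gaussian integrals\<close>

lemma sets_gauss [measurable_cong, simp]: "sets (gauss \<theta>) = sets borel"
  by (simp add: gauss_def)

lemma space_gauss [simp]: "space (gauss \<theta>) = UNIV"
  by (simp add: gauss_def)

text \<open>The density is a product over the standard basis of one-dimensional normal densities of
  variance 1, so Tonelli turns the total mass into a product of ones.\<close>

lemma prob_space_gauss:
  fixes \<theta> :: "real^'d"
  shows "prob_space (gauss \<theta>)"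
proof
  have eq: "(2 * pi) powr (- real CARD('d) / 2) * exp (- (norm (x - \<theta>))\<^sup>2 / 2)
      = (\<Prod>b\<in>Basis. normal_density (\<theta> \<bullet> b) 1 (x \<bullet> b))" for x
  proof -
    have "(norm (x - \<theta>))\<^sup>2 = (\<Sum>b\<in>Basis. (x \<bullet> b - \<theta> \<bullet> b)\<^sup>2)"
      unfolding power2_norm_eq_inner euclidean_inner[of "x - \<theta>" "x - \<theta>"]
      by (simp add: inner_diff_left power2_eq_square)
    hence "exp (- (norm (x - \<theta>))\<^sup>2 / 2) = (\<Prod>b\<in>Basis. exp (- (x \<bullet> b - \<theta> \<bullet> b)\<^sup>2 / 2))"
      by (simp add: exp_sum [symmetric] sum_negf sum_divide_distrib)
    moreover have "(2 * pi) powr (- real CARD('d) / 2) = (\<Prod>b\<in>(Basis :: (real^'d) set). 1 / sqrt (2 * pi))"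
    proof -
      have "(1 / sqrt (2 * pi)) ^ CARD('d) = ((2 * pi) powr (- 1 / 2)) ^ CARD('d)"
        by (simp add: powr_half_sqrt powr_minus_divide)
      also have "\<dots> = (2 * pi) powr (- real CARD('d) / 2)"
        by (simp add: powr_powr powr_realpow [symmetric])
      finally show ?thesis by simp
    qed
    ultimately show ?thesis
      unfolding normal_density_def prod.distrib by simp
  qed
  have nd: "(\<integral>\<^sup>+ x. ennreal (normal_density a 1 x) \<partial>lborel) = 1" for a
    by (subst nn_integral_eq_integral) auto
  have "emeasure (gauss \<theta>) (space (gauss \<theta>))
     = (\<integral>\<^sup>+ x. (\<Prod>b\<in>Basis. ennreal (normal_density (\<theta> \<bullet> b) 1 (x \<bullet> b))) \<partial>lborel)"
    unfolding gauss_def eq by (simp add: emeasure_density prod_ennreal)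
  also have "\<dots> = (\<Prod>b\<in>Basis. \<integral>\<^sup>+ x. ennreal (normal_density (\<theta> \<bullet> b) 1 x) \<partial>lborel)"
    by (rule nn_integral_lborel_prod) auto
  also have "\<dots> = 1"
    by (simp add: nd)
  finally show "emeasure (gauss \<theta>) (space (gauss \<theta>)) = 1" .
qed

lemma gauss_density:
  fixes \<theta> :: "real^'d"
  shows "gauss \<theta> = density (gauss 0) (\<lambda>x. ennreal (exp (\<theta> \<bullet> x - (norm \<theta>)\<^sup>2 / 2)))"
proof -
  have "exp (- (norm (x - \<theta>))\<^sup>2 / 2) = exp (- (norm x)\<^sup>2 / 2) * exp (\<theta> \<bullet> x - (norm \<theta>)\<^sup>2 / 2)"
    for x :: "real^'d"
    by (simp add: exp_add [symmetric] power2_norm_eq_inner inner_diff_left inner_diff_right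
        inner_commute field_simps)
  thus ?thesis
    unfolding gauss_def
    by (subst density_density_eq) (auto simp: ennreal_mult [symmetric] mult.assoc)
qed

text \<open>By Tonelli both sides agree on boxes, and boxes determine a product of sigma-finite
  measures.\<close>

lemma PiM_density:
  assumes I: "finite I"
    and M: "\<And>i. i \<in> I \<Longrightarrow> sigma_finite_measure (M i)"
    and f: "\<And>i. i \<in> I \<Longrightarrow> f i \<in> borel_measurable (M i)"
    and D: "\<And>i. i \<in> I \<Longrightarrow> sigma_finite_measure (density (M i) (f i))"
  shows "PiM I (\<lambda>i. density (M i) (f i)) = density (PiM I M) (\<lambda>x. \<Prod>i\<in>I. f i (x i))"
proof -
  \<comment> \<open>The facts on product measures ask for sigma-finiteness at every index, so
    indices outside \<open>I\<close> get a one-point space and density 1; \<open>PiM I\<close> does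
    not see them.\<close>
  define M' where "M' i = (if i \<in> I then M i else count_space {undefined})" for i
  define f' where "f' i = (if i \<in> I then f i else (\<lambda>_. 1))" for i
  have sc: "sigma_finite_measure (count_space {undefined :: 'b})"
    by (rule sigma_finite_measure_count_space_finite) simp
  interpret M: product_sigma_finite M'
    using M sc by unfold_locales (auto simp: M'_def sigma_finite_measure_def)
  interpret D: product_sigma_finite "\<lambda>i. density (M' i) (f' i)"
    using D sc by (intro product_sigma_finite.intro) (auto simp: M'_def f'_def density_1)
  have f' [measurable]: "\<And>i. f' i \<in> borel_measurable (M' i)"
    using f by (auto simp: M'_def f'_def)
  have "density (PiM I M') (\<lambda>x. \<Prod>i\<in>I. f' i (x i)) = PiM I (\<lambda>i. density (M' i) (f' i))"
  proof (rule D.PiM_eqI [OF I])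
    show "sets (density (PiM I M') (\<lambda>x. \<Prod>i\<in>I. f' i (x i))) = sets (PiM I (\<lambda>i. density (M' i) (f' i)))"
      by (auto intro!: sets_PiM_cong)
    fix A assume A: "\<And>i. i \<in> I \<Longrightarrow> A i \<in> sets (density (M' i) (f' i))"
    hence A' [measurable]: "\<And>i. i \<in> I \<Longrightarrow> A i \<in> sets (M' i)" by simp
    have Pi: "Pi\<^sub>E I A \<in> sets (PiM I M')"
      using I A' by (rule sets_PiM_I_finite)
    have ind: "indicator (Pi\<^sub>E I A) x = (\<Prod>i\<in>I. indicator (A i) (x i) :: ennreal)"
      if "x \<in> space (PiM I M')" for x
    proof (cases "x \<in> Pi\<^sub>E I A")
      case False
      with that obtain i where "i \<in> I" "x i \<notin> A i"
        by (auto simp: space_PiM PiE_def Pi_def extensional_def)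
      hence "(\<Prod>i\<in>I. indicator (A i) (x i) :: ennreal) = 0"
        using I by (intro prod_zero bexI[of _ i]) auto
      with False show ?thesis by simp
    qed (auto simp: PiE_def Pi_def intro!: prod.neutral)
    have "emeasure (density (PiM I M') (\<lambda>x. \<Prod>i\<in>I. f' i (x i))) (Pi\<^sub>E I A)
        = (\<integral>\<^sup>+ x. (\<Prod>i\<in>I. f' i (x i)) * indicator (Pi\<^sub>E I A) x \<partial>PiM I M')"
      using Pi by (subst emeasure_density) auto
    also have "\<dots> = (\<integral>\<^sup>+ x. (\<Prod>i\<in>I. f' i (x i) * indicator (A i) (x i)) \<partial>PiM I M')"
      by (intro nn_integral_cong) (simp add: ind prod.distrib)
    also have "\<dots> = (\<Prod>i\<in>I. \<integral>\<^sup>+ x. f' i x * indicator (A i) x \<partial>M' i)"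
      using I by (intro M.product_nn_integral_prod) auto
    also have "\<dots> = (\<Prod>i\<in>I. emeasure (density (M' i) (f' i)) (A i))"
      using A' by (intro prod.cong refl) (auto simp: emeasure_density)
    finally show "emeasure (density (PiM I M') (\<lambda>x. \<Prod>i\<in>I. f' i (x i))) (Pi\<^sub>E I A)
        = (\<Prod>i\<in>I. emeasure (density (M' i) (f' i)) (A i))" .
  qed
  moreover have "PiM I M' = PiM I M"
    by (intro PiM_cong) (auto simp: M'_def)
  moreover have "PiM I (\<lambda>i. density (M' i) (f' i)) = PiM I (\<lambda>i. density (M i) (f i))"
    by (intro PiM_cong) (auto simp: M'_def f'_def)
  moreover have "(\<lambda>x. \<Prod>i\<in>I. f' i (x i)) = (\<lambda>x. \<Prod>i\<in>I. f i (x i))"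
    by (intro ext prod.cong) (auto simp: f'_def)
  ultimately show ?thesis by simp
qed

lemma sets_samples [measurable_cong]: "sets (samples n \<theta>) = sets (sample_space n)"
  unfolding samples_def sample_space_def by (intro sets_PiM_cong) auto

lemma prob_space_samples: "prob_space (samples n \<theta>)"
  unfolding samples_def by (intro prob_space_PiM prob_space_gauss)

text \<open>The sufficient statistic of the Gaussian location family: likelihood ratios see the
  sample only through it.\<close>

definition sample_sum :: "nat \<Rightarrow> (nat \<Rightarrow> real^'d) \<Rightarrow> real^'d" where
  "sample_sum n X = (\<Sum>j<n. X j)"

lemma measurable_sample_sum [measurable]: "sample_sum n \<in> borel_measurable (sample_space n)"
proof -
  have "(\<lambda>X. X j) \<in> borel_measurable (sample_space n)" if "j < n" for j
    unfolding sample_space_def using that by (intro measurable_component_singleton[THEN measurable_compose]) auto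
  thus ?thesis
    unfolding sample_sum_def by (intro borel_measurable_sum) auto
qed

lemma samples_density:
  "samples n \<theta> = density (samples n 0) (\<lambda>X. ennreal (exp (\<theta> \<bullet> sample_sum n X - n * (norm \<theta>)\<^sup>2 / 2)))"
proof -
  have sf: "sigma_finite_measure (gauss \<theta>)" for \<theta> :: "real^'d"
    by (simp add: prob_space_gauss prob_space_imp_sigma_finite)
  have "samples n \<theta> = PiM {..<n} (\<lambda>_. density (gauss 0) (\<lambda>x. ennreal (exp (\<theta> \<bullet> x - (norm \<theta>)\<^sup>2 / 2))))"
    unfolding samples_def gauss_density[of \<theta>, symmetric] ..
  also have "\<dots> = density (PiM {..<n} (\<lambda>_. gauss 0))
      (\<lambda>X. \<Prod>j<n. ennreal (exp (\<theta> \<bullet> X j - (norm \<theta>)\<^sup>2 / 2)))"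
    by (rule PiM_density) (use sf in \<open>auto simp: gauss_density[symmetric]\<close>)
  also have "(\<lambda>X. \<Prod>j<n. ennreal (exp (\<theta> \<bullet> X j - (norm \<theta>)\<^sup>2 / 2)))
      = (\<lambda>X. ennreal (exp (\<theta> \<bullet> sample_sum n X - n * (norm \<theta>)\<^sup>2 / 2)))"
    by (simp add: prod_ennreal exp_sum [symmetric] sum_subtractf sample_sum_def inner_sum_right)
  finally show ?thesis
    by (simp add: samples_def)
qed

section \<open>The joint law of the data and its moment generating function\<close>

lemma sets_lfht_data [measurable_cong]:
  "sets (lfht_data m n \<theta>1 \<theta>2 \<theta>) = sets ((sample_space n \<Otimes>\<^sub>M sample_space n) \<Otimes>\<^sub>M sample_space m)"
  unfolding lfht_data_def by (intro sets_pair_measure_cong sets_samples)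

lemma prob_space_lfht_data: "prob_space (lfht_data m n \<theta>1 \<theta>2 \<theta>)"
  unfolding lfht_data_def by (intro prob_space_pair prob_space_samples)

text \<open>The likelihood ratio of the data with means \<open>u\<close>, \<open>v\<close>,
  \<open>w\<close> against zero means. All hypotheses thereby become densities on one fixed
  probability space.\<close>

definition lik :: "nat \<Rightarrow> nat \<Rightarrow> real^'d \<Rightarrow> real^'d \<Rightarrow> real^'d \<Rightarrow>
    ((nat \<Rightarrow> real^'d) \<times> (nat \<Rightarrow> real^'d)) \<times> (nat \<Rightarrow> real^'d) \<Rightarrow> real" where
  "lik m n u v w \<omega> = exp (u \<bullet> sample_sum n (fst (fst \<omega>)) + v \<bullet> sample_sum n (snd (fst \<omega>))
     + w \<bullet> sample_sum m (snd \<omega>) - (n * (norm u)\<^sup>2 + n * (norm v)\<^sup>2 + m * (norm w)\<^sup>2) / 2)"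

lemma lfht_data_density:
  "lfht_data m n \<theta>1 \<theta>2 \<theta> = density (lfht_data m n 0 0 0) (\<lambda>\<omega>. ennreal (lik m n \<theta>1 \<theta>2 \<theta> \<omega>))"
proof -
  let ?f = "\<lambda>n \<theta> X. ennreal (exp (\<theta> \<bullet> sample_sum n X - n * (norm \<theta>)\<^sup>2 / 2))"
  have sf: "sigma_finite_measure (samples n \<theta>)" for n and \<theta> :: "real^'d"
    by (simp add: prob_space_samples prob_space_imp_sigma_finite)
  have 1: "samples n \<theta>1 \<Otimes>\<^sub>M samples n \<theta>2
      = density (samples n 0 \<Otimes>\<^sub>M samples n 0) (\<lambda>(X, Y). ?f n \<theta>1 X * ?f n \<theta>2 Y)"
    using sf[of n 0] sf[of n \<theta>2] unfolding samples_density[of n \<theta>1] samples_density[of n \<theta>2]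
    by (intro pair_measure_density) auto
  have "lfht_data m n \<theta>1 \<theta>2 \<theta>
     = density (samples n 0 \<Otimes>\<^sub>M samples n 0) (\<lambda>(X, Y). ?f n \<theta>1 X * ?f n \<theta>2 Y)
        \<Otimes>\<^sub>M density (samples m 0) (?f m \<theta>)"
    unfolding lfht_data_def 1 samples_density[of m \<theta>, symmetric] ..
  also have "\<dots> = density (lfht_data m n 0 0 0) (\<lambda>(XY, Z). (\<lambda>(X, Y). ?f n \<theta>1 X * ?f n \<theta>2 Y) XY * ?f m \<theta> Z)"
    using sf[of m 0] sf[of m \<theta>] unfolding lfht_data_def samples_density[of m \<theta>]
    by (intro pair_measure_density) auto
  also have "(\<lambda>(XY, Z). (\<lambda>(X, Y). ?f n \<theta>1 X * ?f n \<theta>2 Y) XY * ?f m \<theta> Z)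
      = (\<lambda>\<omega>. ennreal (lik m n \<theta>1 \<theta>2 \<theta> \<omega>))"
    by (auto simp: lik_def fun_eq_iff ennreal_mult [symmetric] exp_add [symmetric] field_simps
        intro!: arg_cong[where f = exp])
  finally show ?thesis .
qed

lemma measurable_lik [measurable]:
  "lik m n u v w \<in> borel_measurable ((sample_space n \<Otimes>\<^sub>M sample_space n) \<Otimes>\<^sub>M sample_space m)"
  unfolding lik_def[abs_def] by measurable

text \<open>A density of a probability measure has mean 1. As the three means are arbitrary, this
  amounts to the joint moment generating function of the three sample sums.\<close>

lemma has_bochner_integral_lik:
  "has_bochner_integral (lfht_data m n 0 0 0) (lik m n u v w) 1"
proof (rule has_bochner_integral_nn_integral)
  interpret prob_space "lfht_data m n u v w" by (rule prob_space_lfht_data)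
  show "(\<integral>\<^sup>+ \<omega>. ennreal (lik m n u v w \<omega>) \<partial>lfht_data m n 0 0 0) = ennreal 1"
    using emeasure_space_1 unfolding lfht_data_density[of m n u v w]
    by (simp add: emeasure_density)
qed (auto simp: lik_def)

text \<open>
  Linear combinations f of exponentials in the i-th coordinates of the three sample sums. Under zero
  means these are independent centred Gaussians of variances n, n, m, and e is the mean of f.
\<close>
inductive expsum :: "nat \<Rightarrow> nat \<Rightarrow> (real \<Rightarrow> real \<Rightarrow> real \<Rightarrow> real) \<Rightarrow> real \<Rightarrow> bool" for m n where
  expsum_exp: "expsum m n (\<lambda>x y z. exp (a * x + b * y + c * z)) (exp ((n * a\<^sup>2 + n * b\<^sup>2 + m * c\<^sup>2) / 2))"
| expsum_scale: "expsum m n f e \<Longrightarrow> expsum m n (\<lambda>x y z. k * f x y z) (k * e)"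
| expsum_add: "expsum m n f e \<Longrightarrow> expsum m n g d \<Longrightarrow> expsum m n (\<lambda>x y z. f x y z + g x y z) (e + d)"

definition coords :: "nat \<Rightarrow> nat \<Rightarrow> (real \<Rightarrow> real \<Rightarrow> real \<Rightarrow> real) \<Rightarrow> 'd \<Rightarrow>
    ((nat \<Rightarrow> real^'d) \<times> (nat \<Rightarrow> real^'d)) \<times> (nat \<Rightarrow> real^'d) \<Rightarrow> real" where
  "coords m n f i \<omega> = f (sample_sum n (fst (fst \<omega>)) $ i) (sample_sum n (snd (fst \<omega>)) $ i) (sample_sum m (snd \<omega>) $ i)"

lemma norm_add_axis:
  fixes u :: "real^'d"
  assumes "u $ j = 0"
  shows "(norm (u + axis j a))\<^sup>2 = (norm u)\<^sup>2 + a\<^sup>2"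
  using assms unfolding power2_norm_eq_inner
  by (simp add: inner_add_left inner_add_right inner_axis inner_axis' inner_axis_axis power2_eq_square)

text \<open>
  The tilt by u, v, w, supported off S, makes the induction on S go through: an exponential in a new
  coordinate is absorbed into it.
\<close>
lemma has_bochner_integral_prod_expsum_lik:
  fixes u v w :: "real^'d"
  assumes "finite S" "\<And>i. i \<in> S \<Longrightarrow> expsum m n (f i) (e i)"
    and "\<And>i. i \<in> S \<Longrightarrow> u $ i = 0 \<and> v $ i = 0 \<and> w $ i = 0"
  shows "has_bochner_integral (lfht_data m n 0 0 0)
    (\<lambda>\<omega>. (\<Prod>i\<in>S. coords m n (f i) i \<omega>) * lik m n u v w \<omega>) (\<Prod>i\<in>S. e i)"
  using assms
proof (induction S arbitrary: u v w rule: finite_induct)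
  case empty
  thus ?case by (simp add: has_bochner_integral_lik)
next
  case (insert j S)
  define P where "P \<omega> = (\<Prod>i\<in>S. coords m n (f i) i \<omega>)" for \<omega>
  have "has_bochner_integral (lfht_data m n 0 0 0)
     (\<lambda>\<omega>. coords m n g j \<omega> * (P \<omega> * lik m n u v w \<omega>)) (d * (\<Prod>i\<in>S. e i))"
    if "expsum m n g d" for g d
    using that
  proof induction
    case (expsum_exp a b c)
    \<comment> \<open>\<open>?E\<close> undoes the change in the normalising constant of
      \<open>lik\<close> when the tilt gains \<open>a\<close>, \<open>b\<close>, \<open>c\<close> in
      coordinate \<open>j\<close>. The squared norms just add because \<open>u\<close>,
      \<open>v\<close>, \<open>w\<close> vanish at \<open>j\<close>.\<close>
    let ?E = "exp ((n * a\<^sup>2 + n * b\<^sup>2 + m * c\<^sup>2) / 2)"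
    have 0: "u $ j = 0" "v $ j = 0" "w $ j = 0" using insert.prems by auto
    have "has_bochner_integral (lfht_data m n 0 0 0)
       (\<lambda>\<omega>. P \<omega> * lik m n (u + axis j a) (v + axis j b) (w + axis j c) \<omega>) (\<Prod>i\<in>S. e i)"
      unfolding P_def using insert.prems insert.hyps
      by (intro insert.IH) (auto simp: axis_def)
    from has_bochner_integral_mult_right[OF this, of ?E]
    have "has_bochner_integral (lfht_data m n 0 0 0)
       (\<lambda>\<omega>. ?E * (P \<omega> * lik m n (u + axis j a) (v + axis j b) (w + axis j c) \<omega>)) (?E * (\<Prod>i\<in>S. e i))"
      by simp
    moreover have "?E * (P \<omega> * lik m n (u + axis j a) (v + axis j b) (w + axis j c) \<omega>)
      = coords m n (\<lambda>x y z. exp (a * x + b * y + c * z)) j \<omega> * (P \<omega> * lik m n u v w \<omega>)" for \<omega>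
      unfolding lik_def coords_def norm_add_axis[OF 0(1)] norm_add_axis[OF 0(2)] norm_add_axis[OF 0(3)]
      by (simp add: exp_add[symmetric] inner_add_left inner_axis' algebra_simps add_divide_distrib diff_divide_distrib
          flip: mult.assoc)
    ultimately show ?case by simp
  next
    case (expsum_scale g d k)
    from has_bochner_integral_mult_right[OF expsum_scale.IH, of k]
    show ?case by (simp add: coords_def mult.assoc)
  next
    case (expsum_add g d g' d')
    from has_bochner_integral_add[OF expsum_add.IH]
    show ?case by (simp add: coords_def algebra_simps)
  qed
  from this[OF insert.prems(1)[of j]] insert.hyps
  show ?case by (simp add: P_def mult.assoc)
qed

lemma has_bochner_integral_prod_expsum:
  fixes f :: "'d::finite \<Rightarrow> real \<Rightarrow> real \<Rightarrow> real \<Rightarrow> real"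
  assumes "\<And>i. expsum m n (f i) (e i)"
  shows "has_bochner_integral (lfht_data m n 0 0 0) (\<lambda>\<omega>. \<Prod>i\<in>UNIV. coords m n (f i) i \<omega>) (\<Prod>i\<in>UNIV. e i)"
  using has_bochner_integral_prod_expsum_lik[of UNIV m n f e 0 0 0] assms
  by (simp add: lik_def)

lemma expsum_cosh:
  "expsum m n (\<lambda>x y z. cosh (a * x + b * y + c * z)) (exp ((n * a\<^sup>2 + n * b\<^sup>2 + m * c\<^sup>2) / 2))"
  using expsum_scale[OF expsum_add[OF expsum_exp[of m n a b c] expsum_exp[of m n "-a" "-b" "-c"]], of "1/2"]
  by (simp add: cosh_def scaleR_conv_of_real field_simps)

lemma expsum_const: "expsum m n (\<lambda>x y z. k) k"
  using expsum_scale[OF expsum_exp[of m n 0 0 0], of k] by simp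

subsection \<open>Lower bounds from the existence of a test\<close>

lemma integrable_mult_le_one:
  fixes \<phi> p :: "'a \<Rightarrow> real"
  assumes "integrable M p" "\<phi> \<in> borel_measurable M" "\<And>\<omega>. \<bar>\<phi> \<omega>\<bar> \<le> 1"
  shows "integrable M (\<lambda>\<omega>. \<phi> \<omega> * p \<omega>)"
  using assms
  by (intro Bochner_Integration.integrable_bound[OF assms(1)] AE_I2)
     (auto simp: abs_mult intro!: mult_left_le_one_le)

text \<open>The extremal case is a pair of Bernoulli laws with parameters 1/4 and 3/4, whose
  Hellinger affinity is 2 sqrt (3/16).\<close>

lemma bhattacharyya_le_of_test:
  fixes \<phi> p q :: "'a \<Rightarrow> real"
  assumes [measurable]: "\<phi> \<in> borel_measurable M" and \<phi>: "\<And>\<omega>. 0 \<le> \<phi> \<omega>" "\<And>\<omega>. \<phi> \<omega> \<le> 1"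
    and p: "has_bochner_integral M p 1" "\<And>\<omega>. 0 \<le> p \<omega>"
    and q: "has_bochner_integral M q 1" "\<And>\<omega>. 0 \<le> q \<omega>"
    and err: "(\<integral>\<omega>. \<phi> \<omega> * p \<omega> \<partial>M) \<le> 1/4" "(\<integral>\<omega>. (1 - \<phi> \<omega>) * q \<omega> \<partial>M) \<le> 1/4"
    and b: "integrable M (\<lambda>\<omega>. sqrt (p \<omega> * q \<omega>))"
  shows "(\<integral>\<omega>. sqrt (p \<omega> * q \<omega>) \<partial>M) \<le> sqrt 3 / 2"
proof -
  have ip [simp]: "integrable M p" "integral\<^sup>L M p = 1" and iq [simp]: "integrable M q" "integral\<^sup>L M q = 1"
    using p(1) q(1) by (auto simp: has_bochner_integral_iff)
  have \<phi>': "\<bar>\<phi> \<omega>\<bar> \<le> 1" "\<bar>1 - \<phi> \<omega>\<bar> \<le> 1" for \<omega> using \<phi>[of \<omega>] by auto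
  have i [simp]: "integrable M (\<lambda>\<omega>. \<phi> \<omega> * p \<omega>)" "integrable M (\<lambda>\<omega>. (1 - \<phi> \<omega>) * q \<omega>)"
    using \<phi>' by (auto intro!: integrable_mult_le_one)
  let ?g = "\<lambda>\<omega>. (sqrt 3 / 6) * (p \<omega> + q \<omega> + 2 * (\<phi> \<omega> * p \<omega>) + 2 * ((1 - \<phi> \<omega>) * q \<omega>))"
  \<comment> \<open>AM-GM weighted for equality at c = 3 a, the likelihood ratio in the extremal
    case. It is used with a = p under weight \<open>\<phi>\<close> and with a = q under weight
    \<open>1 - \<phi>\<close>.\<close>
  have amgm: "sqrt (a * c) \<le> sqrt 3 / 6 * (3 * a + c)" if "0 \<le> a" "0 \<le> c" for a c :: real
  proof -
    have "sqrt (a * c) * sqrt 3 = sqrt ((3 * a) * c)" by (simp add: real_sqrt_mult)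
    also have "\<dots> \<le> (3 * a + c) / 2" using that by (intro arith_geo_mean_sqrt) auto
    finally have "sqrt (a * c) * sqrt 3 * sqrt 3 \<le> (3 * a + c) / 2 * sqrt 3"
      by (intro mult_right_mono) auto
    hence "sqrt (a * c) * 6 \<le> (3 * a + c) * sqrt 3" by (simp add: mult.assoc)
    thus ?thesis by (simp add: mult.commute)
  qed
  have pt: "sqrt (p \<omega> * q \<omega>) \<le> ?g \<omega>" for \<omega>
  proof -
    have "\<phi> \<omega> * sqrt (p \<omega> * q \<omega>) \<le> \<phi> \<omega> * (sqrt 3 / 6 * (3 * p \<omega> + q \<omega>))"
      using \<phi> p q by (intro mult_left_mono amgm) auto
    moreover have "(1 - \<phi> \<omega>) * sqrt (q \<omega> * p \<omega>) \<le> (1 - \<phi> \<omega>) * (sqrt 3 / 6 * (3 * q \<omega> + p \<omega>))"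
      using \<phi> p q by (intro mult_left_mono amgm) auto
    ultimately show ?thesis by (simp add: algebra_simps)
  qed
  have "(\<integral>\<omega>. sqrt (p \<omega> * q \<omega>) \<partial>M) \<le> integral\<^sup>L M ?g"
    using b pt by (intro integral_mono) auto
  also have "\<dots> = sqrt 3 / 6 * (2 + 2 * (\<integral>\<omega>. \<phi> \<omega> * p \<omega> \<partial>M) + 2 * (\<integral>\<omega>. (1 - \<phi> \<omega>) * q \<omega> \<partial>M))"
    by simp
  also have "\<dots> \<le> sqrt 3 / 6 * 3"
    using err by (intro mult_left_mono) auto
  finally show ?thesis by simp
qed

text \<open>\<open>F\<close> and \<open>G\<close> majorize p^2 / r and q^2 / r, so a - 1 and b - 1
  bound the chi-square distances to the reference \<open>r\<close>. Errors at most 1/4 force total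
  variation at least 1/2, which forces these two bounds to add up to at least 1/2. Majorants replace
  quotients because exponential sums with known mean can then be used.\<close>

lemma chi_square_ge_of_test:
  fixes \<phi> p q r F G :: "'a \<Rightarrow> real"
  assumes [measurable]: "\<phi> \<in> borel_measurable M" and \<phi>: "\<And>\<omega>. 0 \<le> \<phi> \<omega>" "\<And>\<omega>. \<phi> \<omega> \<le> 1"
    and p: "has_bochner_integral M p 1" and q: "has_bochner_integral M q 1"
    and err: "(\<integral>\<omega>. \<phi> \<omega> * p \<omega> \<partial>M) \<le> 1/4" "(\<integral>\<omega>. (1 - \<phi> \<omega>) * q \<omega> \<partial>M) \<le> 1/4"
    and r: "has_bochner_integral M r 1" "\<And>\<omega>. 0 < r \<omega>"
    and F: "has_bochner_integral M F a" "\<And>\<omega>. (p \<omega>)\<^sup>2 \<le> r \<omega> * F \<omega>"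
    and G: "has_bochner_integral M G b" "\<And>\<omega>. (q \<omega>)\<^sup>2 \<le> r \<omega> * G \<omega>"
  shows "a + b \<ge> 5/2"
proof -
  have ip [simp]: "integrable M p" "integral\<^sup>L M p = 1" and iq [simp]: "integrable M q" "integral\<^sup>L M q = 1"
    and ir [simp]: "integrable M r" "integral\<^sup>L M r = 1"
    and iF [simp]: "integrable M F" "integral\<^sup>L M F = a" and iG [simp]: "integrable M G" "integral\<^sup>L M G = b"
    using p q r F G by (auto simp: has_bochner_integral_iff)
  have \<phi>': "\<bar>\<phi> \<omega>\<bar> \<le> 1" "\<bar>1 - \<phi> \<omega>\<bar> \<le> 1" for \<omega> using \<phi>[of \<omega>] by auto
  have i [simp]: "integrable M (\<lambda>\<omega>. \<phi> \<omega> * p \<omega>)" "integrable M (\<lambda>\<omega>. (1 - \<phi> \<omega>) * q \<omega>)"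
    using \<phi>' by (auto intro!: integrable_mult_le_one)
  \<comment> \<open>\<open>?g\<close> integrates to 1 minus the two errors, and \<open>?v\<close>,
    linear in \<open>F\<close> and \<open>G\<close>, integrates to (2 a + 2 b - 3) / 4.\<close>
  let ?g = "\<lambda>\<omega>. (q \<omega> + p \<omega>) / 2 - \<phi> \<omega> * p \<omega> - (1 - \<phi> \<omega>) * q \<omega>"
  let ?v = "\<lambda>\<omega>. (2 * F \<omega> - 4 * p \<omega> + 2 * G \<omega> - 4 * q \<omega> + 5 * r \<omega>) / 4"
  have pt: "?g \<omega> \<le> ?v \<omega>" for \<omega>
  proof -
    have r0: "r \<omega> > 0" by fact
    have "?g \<omega> = (\<phi> \<omega> - 1/2) * (q \<omega> - p \<omega>)" by (simp add: field_simps)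
    also have "\<dots> \<le> \<bar>\<phi> \<omega> - 1/2\<bar> * \<bar>q \<omega> - p \<omega>\<bar>" by (metis abs_ge_self abs_mult)
    also have "\<dots> \<le> 1/2 * \<bar>q \<omega> - p \<omega>\<bar>"
    proof (rule mult_right_mono)
      show "\<bar>\<phi> \<omega> - 1/2\<bar> \<le> 1/2" using \<phi>[of \<omega>] by linarith
    qed simp
    finally have 1: "?g \<omega> \<le> \<bar>q \<omega> - p \<omega>\<bar> / 2" by simp
    \<comment> \<open>AM-GM removes the absolute value; the parallelogram law then splits the
      difference into the deviations of p and q from r.\<close>
    have "r \<omega> * (2 * \<bar>q \<omega> - p \<omega>\<bar>) \<le> \<bar>q \<omega> - p \<omega>\<bar>\<^sup>2 + (r \<omega>)\<^sup>2"
      using sum_squares_bound[of "\<bar>q \<omega> - p \<omega>\<bar>" "r \<omega>"] by (simp add: mult_ac)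
    also have "\<bar>q \<omega> - p \<omega>\<bar>\<^sup>2 = 2 * (p \<omega> - r \<omega>)\<^sup>2 + 2 * (q \<omega> - r \<omega>)\<^sup>2 - (q \<omega> + p \<omega> - 2 * r \<omega>)\<^sup>2"
      by (simp add: power2_eq_square algebra_simps)
    also have "\<dots> + (r \<omega>)\<^sup>2 \<le> 2 * (p \<omega> - r \<omega>)\<^sup>2 + 2 * (q \<omega> - r \<omega>)\<^sup>2 + (r \<omega>)\<^sup>2" by simp
    also have "\<dots> \<le> r \<omega> * (4 * ?v \<omega>)"
      using F(2)[of \<omega>] G(2)[of \<omega>] by (simp add: power2_eq_square algebra_simps)
    finally have "2 * \<bar>q \<omega> - p \<omega>\<bar> \<le> 4 * ?v \<omega>"
      using r0 by (simp add: mult_le_cancel_left_pos)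
    with 1 show ?thesis by linarith
  qed
  have "integral\<^sup>L M ?g \<le> integral\<^sup>L M ?v"
    using pt by (intro integral_mono) auto
  with err show ?thesis by simp
qed

text \<open>With \<open>\<phi>\<close> the indicator of deciding H_1, error probabilities are
  integrals over a single law, linear in the likelihood ratio, and can be averaged over a
  prior.\<close>

lemma test_of_lfht_feasible:
  fixes \<Gamma> :: "(real^'d) set"
  assumes "lfht_feasible \<Gamma> \<epsilon> m n"
  obtains \<phi> where "\<phi> \<in> borel_measurable (lfht_data m n 0 0 0)" "\<And>\<omega>. 0 \<le> \<phi> \<omega>" "\<And>\<omega>. \<phi> \<omega> \<le> 1"
    "\<And>\<theta>1 \<theta>2. \<theta>1 \<in> \<Gamma> \<Longrightarrow> \<theta>2 \<in> \<Gamma> \<Longrightarrow> dist \<theta>1 \<theta>2 \<ge> \<epsilon> \<Longrightarrow>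
       (\<integral>\<omega>. \<phi> \<omega> * lik m n \<theta>1 \<theta>2 \<theta>1 \<omega> \<partial>lfht_data m n 0 0 0) \<le> 1/4"
    "\<And>\<theta>1 \<theta>2. \<theta>1 \<in> \<Gamma> \<Longrightarrow> \<theta>2 \<in> \<Gamma> \<Longrightarrow> dist \<theta>1 \<theta>2 \<ge> \<epsilon> \<Longrightarrow>
       (\<integral>\<omega>. (1 - \<phi> \<omega>) * lik m n \<theta>1 \<theta>2 \<theta>2 \<omega> \<partial>lfht_data m n 0 0 0) \<le> 1/4"
proof -
  let ?S = "(sample_space n \<Otimes>\<^sub>M sample_space n) \<Otimes>\<^sub>M sample_space m :: (((nat \<Rightarrow> real^'d) \<times> (nat \<Rightarrow> real^'d)) \<times> (nat \<Rightarrow> real^'d)) measure"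
  from assms obtain \<psi> where \<psi> [measurable]: "\<psi> \<in> measurable ?S (count_space UNIV)"
    and err: "\<And>\<theta>1 \<theta>2. \<theta>1 \<in> \<Gamma> \<Longrightarrow> \<theta>2 \<in> \<Gamma> \<Longrightarrow> dist \<theta>1 \<theta>2 \<ge> \<epsilon> \<Longrightarrow>
        measure (lfht_data m n \<theta>1 \<theta>2 \<theta>1) {w \<in> space (lfht_data m n \<theta>1 \<theta>2 \<theta>1). \<psi> w \<noteq> False} \<le> 1/4 \<and>
        measure (lfht_data m n \<theta>1 \<theta>2 \<theta>2) {w \<in> space (lfht_data m n \<theta>1 \<theta>2 \<theta>2). \<psi> w \<noteq> True} \<le> 1/4"
    unfolding lfht_feasible_def by blast
  have sp: "space (lfht_data m n \<theta>1 \<theta>2 \<theta>) = space ?S" for \<theta>1 \<theta>2 \<theta>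
    by (rule sets_eq_imp_space_eq[OF sets_lfht_data])
  have meas: "measure (lfht_data m n \<theta>1 \<theta>2 \<theta>) A
      = (\<integral>\<omega>. indicator A \<omega> * lik m n \<theta>1 \<theta>2 \<theta> \<omega> \<partial>lfht_data m n 0 0 0)"
    if [measurable]: "A \<in> sets ?S" for A \<theta>1 \<theta>2 \<theta>
  proof -
    interpret prob_space "lfht_data m n \<theta>1 \<theta>2 \<theta>" by (rule prob_space_lfht_data)
    have "A \<in> sets (lfht_data m n \<theta>1 \<theta>2 \<theta>)" by measurable
    hence "measure (lfht_data m n \<theta>1 \<theta>2 \<theta>) A = (\<integral>\<omega>. indicator A \<omega> \<partial>lfht_data m n \<theta>1 \<theta>2 \<theta>)"
      by simp
    also have "\<dots> = (\<integral>\<omega>. lik m n \<theta>1 \<theta>2 \<theta> \<omega> *\<^sub>R indicator A \<omega> \<partial>lfht_data m n 0 0 0)"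
      unfolding lfht_data_density[of m n \<theta>1 \<theta>2 \<theta>]
      by (rule integral_density) (auto simp: lik_def)
    finally show ?thesis by (simp add: mult.commute)
  qed
  define A where "A = {w \<in> space ?S. \<psi> w}"
  have A [measurable]: "A \<in> sets ?S" unfolding A_def by measurable
  have B: "{w \<in> space ?S. \<not> \<psi> w} \<in> sets ?S" by measurable
  show thesis
  proof (rule that[of "indicator A"])
    fix \<theta>1 \<theta>2 assume *: "\<theta>1 \<in> \<Gamma>" "\<theta>2 \<in> \<Gamma>" "dist \<theta>1 \<theta>2 \<ge> \<epsilon>"
    show "(\<integral>\<omega>. indicator A \<omega> * lik m n \<theta>1 \<theta>2 \<theta>1 \<omega> \<partial>lfht_data m n 0 0 0) \<le> 1/4"
      using err[OF *] meas[OF A, of \<theta>1 \<theta>2 \<theta>1] by (simp add: sp A_def)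
    have "(\<integral>\<omega>. (1 - indicator A \<omega>) * lik m n \<theta>1 \<theta>2 \<theta>2 \<omega> \<partial>lfht_data m n 0 0 0)
      = (\<integral>\<omega>. indicator {w \<in> space ?S. \<not> \<psi> w} \<omega> * lik m n \<theta>1 \<theta>2 \<theta>2 \<omega> \<partial>lfht_data m n 0 0 0)"
      by (intro Bochner_Integration.integral_cong) (auto simp: A_def sp indicator_def)
    thus "(\<integral>\<omega>. (1 - indicator A \<omega>) * lik m n \<theta>1 \<theta>2 \<theta>2 \<omega> \<partial>lfht_data m n 0 0 0) \<le> 1/4"
      using err[OF *] meas[OF B, of \<theta>1 \<theta>2 \<theta>2] by (simp add: sp)
  qed (auto simp: indicator_def)
qed

text \<open>The geometric mean of two likelihood ratios is a constant times the likelihood ratio at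
  the midpoints of the means; the parallelogram identity \<open>par\<close> gives the
  constant.\<close>

lemma has_bochner_integral_sqrt_lik:
  "has_bochner_integral (lfht_data m n 0 0 0) (\<lambda>\<omega>. sqrt (lik m n a b c \<omega> * lik m n a' b' c' \<omega>))
     (exp (- (n * (norm (a - a'))\<^sup>2 + n * (norm (b - b'))\<^sup>2 + m * (norm (c - c'))\<^sup>2) / 8))"
proof -
  let ?E = "exp (- (n * (norm (a - a'))\<^sup>2 + n * (norm (b - b'))\<^sup>2 + m * (norm (c - c'))\<^sup>2) / 8)"
  have half: "sqrt (exp x) = exp (x / 2)" for x :: real
    by (rule real_sqrt_unique) (simp_all add: power2_eq_square exp_add[symmetric])
  have par: "(norm ((1/2) *\<^sub>R (x + y)))\<^sup>2 = ((norm x)\<^sup>2 + (norm y)\<^sup>2) / 2 - (norm (x - y))\<^sup>2 / 4"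
    for x y :: "real^'b"
    unfolding power2_norm_eq_inner
    by (simp add: inner_add_left inner_add_right inner_diff_left inner_diff_right inner_commute field_simps)
  have "sqrt (lik m n a b c \<omega> * lik m n a' b' c' \<omega>)
      = ?E * lik m n ((1/2) *\<^sub>R (a + a')) ((1/2) *\<^sub>R (b + b')) ((1/2) *\<^sub>R (c + c')) \<omega>" for \<omega>
    unfolding lik_def exp_add[symmetric] half par
    by (simp add: inner_add_left field_simps)
  thus ?thesis
    using has_bochner_integral_mult_right[OF has_bochner_integral_lik[of m n
       "(1/2) *\<^sub>R (a + a')" "(1/2) *\<^sub>R (b + b')" "(1/2) *\<^sub>R (c + c')"], of ?E] by simp
qed

subsection \<open>Mixtures over random signs\<close>

text \<open>An extensional function space, so that a product of two-term sums expands into a sum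
  over \<open>signs\<close>.\<close>

definition signs :: "('d::finite \<Rightarrow> real) set" where
  "signs = (UNIV \<rightarrow>\<^sub>E {-1, 1})"

definition flip :: "('d \<Rightarrow> real) \<Rightarrow> real^'d \<Rightarrow> real^'d" where
  "flip \<xi> x = (\<chi> i. \<xi> i * x $ i)"

lemma finite_signs [simp]: "finite (signs :: ('d::finite \<Rightarrow> real) set)"
  unfolding signs_def by (intro finite_PiE) auto

lemma card_signs: "card (signs :: ('d::finite \<Rightarrow> real) set) = 2 ^ CARD('d)"
  unfolding signs_def by (subst card_PiE) (auto simp: numeral_2_eq_2)

lemma signs_square: "\<xi> \<in> signs \<Longrightarrow> (\<xi> i)\<^sup>2 = 1"
proof -
  assume "\<xi> \<in> signs"
  hence "\<xi> i \<in> {-1, 1}" unfolding signs_def by (rule PiE_mem) simp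
  thus ?thesis by auto
qed

lemma norm_square_vec: "(norm (u :: real^'d))\<^sup>2 = (\<Sum>i\<in>UNIV. (u $ i)\<^sup>2)"
  unfolding power2_norm_eq_inner by (simp add: inner_vec_def power2_eq_square)

lemma norm_flip: "\<xi> \<in> signs \<Longrightarrow> norm (flip \<xi> u) = norm u"
  by (rule power2_eq_imp_eq[OF _ norm_ge_zero norm_ge_zero])
     (simp add: norm_square_vec flip_def power_mult_distrib signs_square)

lemma flip_diff: "flip \<xi> u - flip \<xi> v = flip \<xi> (u - v)"
  by (simp add: flip_def vec_eq_iff algebra_simps)

text \<open>The likelihood ratio of one coordinate, averaged over one sign common to the means
  \<open>a\<close>, \<open>b\<close>, \<open>c\<close>; the arguments \<open>x\<close>,
  \<open>y\<close>, \<open>z\<close> are coordinates of the sample sums.\<close>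

definition mix :: "nat \<Rightarrow> nat \<Rightarrow> real \<Rightarrow> real \<Rightarrow> real \<Rightarrow> real \<Rightarrow> real \<Rightarrow> real \<Rightarrow> real" where
  "mix m n a b c x y z = exp (- (n * a\<^sup>2 + n * b\<^sup>2 + m * c\<^sup>2) / 2) * cosh (a * x + b * y + c * z)"

definition mixlik :: "nat \<Rightarrow> nat \<Rightarrow> real^'d \<Rightarrow> real^'d \<Rightarrow> real^'d \<Rightarrow>
    ((nat \<Rightarrow> real^'d) \<times> (nat \<Rightarrow> real^'d)) \<times> (nat \<Rightarrow> real^'d) \<Rightarrow> real" where
  "mixlik m n u v w \<omega> = (\<Prod>i\<in>UNIV. coords m n (mix m n (u $ i) (v $ i) (w $ i)) i \<omega>)"

lemma expsum_mix: "expsum m n (mix m n a b c) 1"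
  using expsum_scale[OF expsum_cosh[of m n a b c], of "exp (- (n * a\<^sup>2 + n * b\<^sup>2 + m * c\<^sup>2) / 2)"]
  unfolding mix_def[abs_def] exp_add[symmetric] add_divide_distrib[symmetric] by simp

text \<open>The likelihood factorises over coordinates and the signs are independent, so the average
  can be taken coordinate by coordinate.\<close>

lemma mixlik_average:
  fixes u v w :: "real^'d"
  shows "mixlik m n u v w \<omega> = (\<Sum>\<xi>\<in>signs. lik m n (flip \<xi> u) (flip \<xi> v) (flip \<xi> w) \<omega>) / card (signs :: ('d \<Rightarrow> real) set)"
proof -
  define t where "t i = u $ i * sample_sum n (fst (fst \<omega>)) $ i + v $ i * sample_sum n (snd (fst \<omega>)) $ i
      + w $ i * sample_sum m (snd \<omega>) $ i" for i
  define q where "q i = (n * (u $ i)\<^sup>2 + n * (v $ i)\<^sup>2 + m * (w $ i)\<^sup>2) / 2" for i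
  have "lik m n (flip \<xi> u) (flip \<xi> v) (flip \<xi> w) \<omega> = (\<Prod>i\<in>UNIV. exp (\<xi> i * t i - q i))" if "\<xi> \<in> signs" for \<xi>
    unfolding lik_def norm_flip[OF that] exp_sum[OF finite, symmetric] t_def q_def norm_square_vec
    by (simp add: flip_def inner_vec_def sum.distrib sum_subtractf sum_distrib_left sum_divide_distrib
        algebra_simps add_divide_distrib)
  hence "(\<Sum>\<xi>\<in>signs. lik m n (flip \<xi> u) (flip \<xi> v) (flip \<xi> w) \<omega>)
       = (\<Sum>\<xi>\<in>signs. \<Prod>i\<in>UNIV. exp (\<xi> i * t i - q i))" by simp
  also have "\<dots> = (\<Prod>i\<in>UNIV. \<Sum>s\<in>{-1, 1}. exp (s * t i - q i))"
    unfolding signs_def by (rule prod_sum_PiE[symmetric]) auto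
  also have "\<dots> = (\<Prod>i\<in>UNIV. 2 * coords m n (mix m n (u $ i) (v $ i) (w $ i)) i \<omega>)"
  proof (intro prod.cong refl)
    fix i
    have "coords m n (mix m n (u $ i) (v $ i) (w $ i)) i \<omega> = exp (- q i) * cosh (t i)"
      by (simp add: coords_def mix_def t_def q_def minus_divide_left)
    thus "(\<Sum>s\<in>{-1, 1}. exp (s * t i - q i)) = 2 * coords m n (mix m n (u $ i) (v $ i) (w $ i)) i \<omega>"
      by (simp add: cosh_def exp_diff exp_minus field_simps)
  qed
  also have "\<dots> = 2 ^ CARD('d) * mixlik m n u v w \<omega>"
    by (simp add: prod.distrib mixlik_def)
  finally show ?thesis by (simp add: card_signs)
qed

lemma average_error_le:
  fixes \<phi> :: "'a \<Rightarrow> real"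
  assumes "finite I" "I \<noteq> {}" "\<And>i. i \<in> I \<Longrightarrow> integrable M (\<lambda>\<omega>. \<phi> \<omega> * p i \<omega>)"
    and "\<And>i. i \<in> I \<Longrightarrow> (\<integral>\<omega>. \<phi> \<omega> * p i \<omega> \<partial>M) \<le> c"
  shows "(\<integral>\<omega>. \<phi> \<omega> * ((\<Sum>i\<in>I. p i \<omega>) / card I) \<partial>M) \<le> c"
proof -
  have "(\<integral>\<omega>. \<phi> \<omega> * ((\<Sum>i\<in>I. p i \<omega>) / card I) \<partial>M) = (\<integral>\<omega>. (\<Sum>i\<in>I. \<phi> \<omega> * p i \<omega>) / card I \<partial>M)"
    by (simp add: sum_distrib_left)
  also have "\<dots> = (\<Sum>i\<in>I. \<integral>\<omega>. \<phi> \<omega> * p i \<omega> \<partial>M) / card I"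
    using assms by simp
  also have "\<dots> \<le> (card I * c) / card I"
    using assms by (intro divide_right_mono sum_bounded_above) auto
  finally show ?thesis using assms by simp
qed

text \<open>Averaging over signs keeps both errors at most 1/4, and mixtures, reference and
  majorants are products over coordinates. The chi-square bound then says that twice the product of
  the \<open>e i\<close> is at least 5/2; the claim follows by taking logarithms.\<close>

lemma chi_square_ge_of_mixture_test:
  fixes a b a' b' :: "real^'d"
  assumes \<phi>m [measurable]: "\<phi> \<in> borel_measurable (lfht_data m n 0 0 0)"
    and \<phi>: "\<And>\<omega>. 0 \<le> \<phi> \<omega>" "\<And>\<omega>. \<phi> \<omega> \<le> 1"
    and e0: "\<And>\<xi>. \<xi> \<in> signs \<Longrightarrow> (\<integral>\<omega>. \<phi> \<omega> * lik m n (flip \<xi> a) (flip \<xi> b) (flip \<xi> c) \<omega> \<partial>lfht_data m n 0 0 0) \<le> 1/4"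
    and e1: "\<And>\<xi>. \<xi> \<in> signs \<Longrightarrow> (\<integral>\<omega>. (1 - \<phi> \<omega>) * lik m n (flip \<xi> a') (flip \<xi> b') (flip \<xi> c') \<omega> \<partial>lfht_data m n 0 0 0) \<le> 1/4"
    and r: "\<And>i. expsum m n (r i) 1" "\<And>i x y z. 0 < r i x y z"
    and F: "\<And>i. expsum m n (F i) (e i)" "\<And>i x y z. (mix m n (a $ i) (b $ i) (c $ i) x y z)\<^sup>2 \<le> r i x y z * F i x y z"
    and G: "\<And>i. expsum m n (G i) (e i)" "\<And>i x y z. (mix m n (a' $ i) (b' $ i) (c' $ i) x y z)\<^sup>2 \<le> r i x y z * G i x y z"
    and s: "\<And>i. 0 \<le> e i" "\<And>i. e i \<le> exp (s i)"
  shows "(\<Sum>i\<in>UNIV. s i) \<ge> 1/5"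
proof -
  have ne: "(signs :: ('d \<Rightarrow> real) set) \<noteq> {}"
    using card_signs[where 'd = 'd] by (metis card.empty power_not_zero zero_neq_numeral)
  have il: "integrable (lfht_data m n 0 0 0) (lik m n u v w)" for u v w :: "real^'d"
    using has_bochner_integral_lik[of m n u v w] by (simp add: has_bochner_integral_iff)
  have \<phi>': "\<bar>\<phi> \<omega>\<bar> \<le> 1" "\<bar>1 - \<phi> \<omega>\<bar> \<le> 1" for \<omega> using \<phi>[of \<omega>] by auto
  have 1: "(\<integral>\<omega>. \<phi> \<omega> * mixlik m n a b c \<omega> \<partial>lfht_data m n 0 0 0) \<le> 1/4"
    unfolding mixlik_average using ne e0 \<phi>'
    by (intro average_error_le integrable_mult_le_one il) auto
  have 2: "(\<integral>\<omega>. (1 - \<phi> \<omega>) * mixlik m n a' b' c' \<omega> \<partial>lfht_data m n 0 0 0) \<le> 1/4"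
    unfolding mixlik_average using ne e1 \<phi>'
    by (intro average_error_le integrable_mult_le_one il) auto
  have h: "has_bochner_integral (lfht_data m n 0 0 0) (mixlik m n u v w) 1" for u v w :: "real^'d"
    using has_bochner_integral_prod_expsum[of m n "\<lambda>i. mix m n (u $ i) (v $ i) (w $ i)" "\<lambda>_. 1"] expsum_mix
    by (simp add: mixlik_def[abs_def])
  have le: "(mixlik m n u v w \<omega>)\<^sup>2 \<le> (\<Prod>i\<in>UNIV. coords m n (r i) i \<omega>) * (\<Prod>i\<in>UNIV. coords m n (H i) i \<omega>)"
    if "\<And>i x y z. (mix m n (u $ i) (v $ i) (w $ i) x y z)\<^sup>2 \<le> r i x y z * H i x y z"
    for u v w :: "real^'d" and H \<omega>
    unfolding mixlik_def prod_power_distrib prod.distrib[symmetric]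
    using that by (intro prod_mono) (auto simp: coords_def)
  have "(\<Prod>i\<in>UNIV. e i) + (\<Prod>i\<in>UNIV. e i) \<ge> 5/2"
    using \<phi>m \<phi> h h 1 2
  proof (rule chi_square_ge_of_test)
    show "has_bochner_integral (lfht_data m n 0 0 0) (\<lambda>\<omega>. \<Prod>i\<in>UNIV. coords m n (r i) i \<omega>) 1"
      using has_bochner_integral_prod_expsum[OF r(1)] by simp
    show "0 < (\<Prod>i\<in>UNIV. coords m n (r i) i \<omega>)" for \<omega>
      using r(2) by (intro prod_pos) (auto simp: coords_def)
    show "has_bochner_integral (lfht_data m n 0 0 0) (\<lambda>\<omega>. \<Prod>i\<in>UNIV. coords m n (F i) i \<omega>) (\<Prod>i\<in>UNIV. e i)"
      "has_bochner_integral (lfht_data m n 0 0 0) (\<lambda>\<omega>. \<Prod>i\<in>UNIV. coords m n (G i) i \<omega>) (\<Prod>i\<in>UNIV. e i)"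
      by (intro has_bochner_integral_prod_expsum F G)+
    show "(mixlik m n a b c \<omega>)\<^sup>2 \<le> (\<Prod>i\<in>UNIV. coords m n (r i) i \<omega>) * (\<Prod>i\<in>UNIV. coords m n (F i) i \<omega>)" for \<omega>
      by (intro le F)
    show "(mixlik m n a' b' c' \<omega>)\<^sup>2 \<le> (\<Prod>i\<in>UNIV. coords m n (r i) i \<omega>) * (\<Prod>i\<in>UNIV. coords m n (G i) i \<omega>)" for \<omega>
      by (intro le G)
  qed
  moreover have "(\<Prod>i\<in>UNIV. e i) \<le> (\<Prod>i\<in>UNIV. exp (s i))"
    using s by (intro prod_mono) auto
  ultimately have "5/4 \<le> exp (\<Sum>i\<in>UNIV. s i)" by (simp add: exp_sum)
  hence "ln (5/4) \<le> ln (exp (\<Sum>i\<in>UNIV. s i))" by (subst ln_le_cancel_iff) auto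
  moreover have "ln (5/4 :: real) \<ge> 1/5"
    using ln_le_minus_one[of "4/5 :: real"] by (simp add: ln_div)
  ultimately show ?thesis by simp
qed

section \<open>Mixtures with theta = 0\<close>

text \<open>This is Hoeffding's lemma for a uniform sign, in the form of a fair two-point law on 0
  and 2 t after centring; evenness covers negative t.\<close>

lemma cosh_le_exp_half_square: "cosh (t :: real) \<le> exp (t\<^sup>2 / 2)"
proof -
  have *: "cosh t \<le> exp (t\<^sup>2 / 2)" if "t \<ge> 0" for t :: real
  proof -
    have "exp (- t) * ((1 + exp (2 * t)) / 2) = cosh t"
      by (simp add: cosh_def exp_minus field_simps flip: exp_add)
    hence "ln (cosh t) = - t + ln ((1 + exp (2 * t)) / 2)"
      by (metis add_pos_pos exp_gt_zero half_gt_zero ln_exp ln_mult zero_less_one order_less_irrefl)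
    also have "\<dots> \<le> (2 * t)\<^sup>2 / 8"
      using Hoeffdings_lemma_aux[of "2 * t" "1/2"] that by (simp add: field_simps)
    finally have "ln (cosh t) \<le> t\<^sup>2 / 2" by (simp add: power_mult_distrib)
    hence "exp (ln (cosh t)) \<le> exp (t\<^sup>2 / 2)" by (simp only: exp_le_cancel_iff)
    moreover have "exp (ln (cosh t)) = cosh t" by (simp add: cosh_real_pos)
    ultimately show ?thesis by (simp only:)
  qed
  show ?thesis using *[of t] *[of "-t"] by (cases "t \<ge> 0") auto
qed

text \<open>H_0 has theta1 = 0 and H_1 has theta2 = 0, so Z is the same centred noise in both and
  only \<open>n\<close> enters. Against the zero-mean law (r = 1), one plus the chi-square distance
  is the product of the cosh (n x_i^2).\<close>

lemma mixture_bound_n: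
  fixes x :: "real^'d"
  assumes \<phi>m [measurable]: "\<phi> \<in> borel_measurable (lfht_data m n 0 0 0)"
    and \<phi>: "\<And>\<omega>. 0 \<le> \<phi> \<omega>" "\<And>\<omega>. \<phi> \<omega> \<le> 1"
    and e0: "\<And>\<xi>. \<xi> \<in> signs \<Longrightarrow> (\<integral>\<omega>. \<phi> \<omega> * lik m n 0 (flip \<xi> x) 0 \<omega> \<partial>lfht_data m n 0 0 0) \<le> 1/4"
    and e1: "\<And>\<xi>. \<xi> \<in> signs \<Longrightarrow> (\<integral>\<omega>. (1 - \<phi> \<omega>) * lik m n (flip \<xi> x) 0 0 \<omega> \<partial>lfht_data m n 0 0 0) \<le> 1/4"
  shows "(real n)\<^sup>2 * (\<Sum>i\<in>UNIV. (x $ i) ^ 4) \<ge> 2/5"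
proof -
  have f0: "flip \<xi> 0 = 0" for \<xi> :: "'d \<Rightarrow> real" by (simp add: flip_def vec_eq_iff)
  \<comment> \<open>The double-angle formula makes the squared mixture density itself an exponential
    sum, so no majorant is called for.\<close>
  have sq: "(cosh t)\<^sup>2 = (cosh (2 * t) + 1) / 2" for t :: real
    using cosh_square_eq[of t] by (simp add: cosh_double_cosh)
  have E: "expsum m n (\<lambda>x y z. (mix m n a b 0 x y z)\<^sup>2) (cosh (n * (a\<^sup>2 + b\<^sup>2)))" for a b :: real
  proof -
    have "expsum m n (\<lambda>x y z. (exp (- (n * (a\<^sup>2 + b\<^sup>2))) / 2) * (cosh (2 * a * x + 2 * b * y + 0 * z) + 1))
       ((exp (- (n * (a\<^sup>2 + b\<^sup>2))) / 2) * (exp ((n * (2 * a)\<^sup>2 + n * (2 * b)\<^sup>2 + m * (0::real)\<^sup>2) / 2) + 1))"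
      by (intro expsum_scale expsum_add expsum_cosh expsum_const)
    moreover have "(mix m n a b 0 x y z)\<^sup>2
        = (exp (- (n * (a\<^sup>2 + b\<^sup>2))) / 2) * (cosh (2 * a * x + 2 * b * y + 0 * z) + 1)" for x y z
    proof -
      have "(exp (- (n * a\<^sup>2 + n * b\<^sup>2 + m * 0\<^sup>2) / 2))\<^sup>2 = exp (- (n * (a\<^sup>2 + b\<^sup>2)))"
        unfolding exp_double[symmetric] by (simp add: distrib_left)
      thus ?thesis unfolding mix_def power_mult_distrib sq by (simp add: distrib_left mult.assoc)
    qed
    moreover have "(exp (- (n * (a\<^sup>2 + b\<^sup>2))) / 2) * (exp ((n * (2 * a)\<^sup>2 + n * (2 * b)\<^sup>2 + m * (0::real)\<^sup>2) / 2) + 1)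
        = cosh (n * (a\<^sup>2 + b\<^sup>2))"
      by (simp add: cosh_def field_simps flip: exp_add)
    ultimately show ?thesis by (simp only:)
  qed
  have "(\<Sum>i\<in>UNIV. (real n * (x $ i)\<^sup>2)\<^sup>2 / 2) \<ge> 1/5"
  proof (rule chi_square_ge_of_mixture_test[OF \<phi>m \<phi>, of 0 x 0 x 0 0 "\<lambda>_ _ _ _. 1"
        "\<lambda>i x' y z. (mix m n 0 (x $ i) 0 x' y z)\<^sup>2" "\<lambda>i. cosh (n * (x $ i)\<^sup>2)"
        "\<lambda>i x' y z. (mix m n (x $ i) 0 0 x' y z)\<^sup>2"])
    show "expsum m n (\<lambda>x' y z. (mix m n 0 (x $ i) 0 x' y z)\<^sup>2) (cosh (n * (x $ i)\<^sup>2))" for i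
      using E[of 0 "x $ i"] by simp
    show "expsum m n (\<lambda>x' y z. (mix m n (x $ i) 0 0 x' y z)\<^sup>2) (cosh (n * (x $ i)\<^sup>2))" for i
      using E[of "x $ i" 0] by simp
  qed (use e0 e1 in \<open>auto simp: f0 intro: expsum_const cosh_le_exp_half_square\<close>)
  also have "(\<Sum>i\<in>UNIV. (real n * (x $ i)\<^sup>2)\<^sup>2 / 2) = (real n)\<^sup>2 * (\<Sum>i\<in>UNIV. (x $ i) ^ 4) / 2"
    by (simp add: power_mult_distrib sum_distrib_left sum_divide_distrib flip: power_mult)
  finally show ?thesis by simp
qed

section \<open>Mixtures with theta1 = -theta2\<close>

text \<open>sinh^2 / cosh equals cosh - 1 / cosh. For k > 0, convexity puts 1 / cosh above its
  tangent 2 k - k^2 cosh, and what results is linear in cosh.\<close>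

lemma sinh_square_le:
  "(sinh (t :: real))\<^sup>2 \<le> cosh t * ((1 + k\<^sup>2) * cosh t - 2 * k)"
proof -
  have "cosh t * ((1 + k\<^sup>2) * cosh t - 2 * k) - (sinh t)\<^sup>2 = (k * cosh t - 1)\<^sup>2"
    using cosh_square_eq[of t] by (simp add: power2_eq_square algebra_simps)
  thus ?thesis by (metis diff_ge_0_iff_ge zero_le_power2)
qed

text \<open>
  Per coordinate, the product of the marginal densities of (X, Y) and Z, and an exponential sum that
  dominates the squared mixture density divided by it. The quotients sinh^2 / cosh which appear in
  the latter are bounded by the previous inequality, an equality at cosh t = 1 / k, with 1 / k the
  mean of cosh.
\<close>
definition ref_mn :: "nat \<Rightarrow> nat \<Rightarrow> real \<Rightarrow> real \<Rightarrow> real \<Rightarrow> real \<Rightarrow> real" where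
  "ref_mn m n t x y z = exp (- real n * t\<^sup>2) * exp (- real m * t\<^sup>2 / 2) * (cosh (t * x - t * y) * cosh (t * z))"

definition bound_mn :: "nat \<Rightarrow> nat \<Rightarrow> real \<Rightarrow> real \<Rightarrow> real \<Rightarrow> real \<Rightarrow> real \<Rightarrow> real" where
  "bound_mn m n t c x y z = exp (- real n * t\<^sup>2) * exp (- real m * t\<^sup>2 / 2) *
     (cosh (t * x - t * y) * cosh (c * z) + 2 * (sinh (t * x - t * y) * sinh (c * z)) +
      ((1 + (exp (- real n * t\<^sup>2))\<^sup>2) * cosh (t * x - t * y) - 2 * exp (- real n * t\<^sup>2)) *
      ((1 + (exp (- real m * t\<^sup>2 / 2))\<^sup>2) * cosh (c * z) - 2 * exp (- real m * t\<^sup>2 / 2)))"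

text \<open>The two values of \<open>c\<close> are the two hypotheses; as cosh is even, they share
  the reference. Dividing the squared addition formula for cosh by the reference leaves three terms,
  and only the last, a product of two quotients sinh^2 / cosh, has to be bounded.\<close>

lemma mix_square_le_bound_mn:
  assumes "c = t \<or> c = -t"
  shows "(mix m n t (-t) c x y z)\<^sup>2 \<le> ref_mn m n t x y z * bound_mn m n t c x y z"
proof -
  define \<alpha> \<beta> ka kb where "\<alpha> = t * x - t * y" and "\<beta> = c * z"
    and "ka = exp (- real n * t\<^sup>2)" and "kb = exp (- real m * t\<^sup>2 / 2)"
  have c: "cosh (t * z) = cosh \<beta>" "c\<^sup>2 = t\<^sup>2"
    using assms by (auto simp: \<beta>_def)
  have mix: "mix m n t (-t) c x y z = ka * kb * (cosh \<alpha> * cosh \<beta> + sinh \<alpha> * sinh \<beta>)"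
  proof -
    have "mix m n t (-t) c x y z = exp (- real n * t\<^sup>2 + - real m * t\<^sup>2 / 2) * cosh (\<alpha> + \<beta>)"
      by (simp add: mix_def c \<alpha>_def \<beta>_def field_simps)
    thus ?thesis unfolding cosh_add exp_add ka_def kb_def .
  qed
  have ref: "ref_mn m n t x y z = ka * kb * (cosh \<alpha> * cosh \<beta>)"
    by (simp add: ref_mn_def c ka_def kb_def \<alpha>_def)
  have bound: "bound_mn m n t c x y z = ka * kb * (cosh \<alpha> * cosh \<beta> + 2 * (sinh \<alpha> * sinh \<beta>)
         + ((1 + ka\<^sup>2) * cosh \<alpha> - 2 * ka) * ((1 + kb\<^sup>2) * cosh \<beta> - 2 * kb))"
    by (simp add: bound_mn_def ka_def kb_def \<alpha>_def \<beta>_def)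
  have "(sinh \<alpha>)\<^sup>2 * (sinh \<beta>)\<^sup>2 \<le> (cosh \<alpha> * ((1 + ka\<^sup>2) * cosh \<alpha> - 2 * ka)) * (cosh \<beta> * ((1 + kb\<^sup>2) * cosh \<beta> - 2 * kb))"
    by (intro mult_mono sinh_square_le order_trans[OF zero_le_power2 sinh_square_le]) auto
  hence "(cosh \<alpha> * cosh \<beta> + sinh \<alpha> * sinh \<beta>)\<^sup>2
      \<le> (cosh \<alpha> * cosh \<beta>) * (cosh \<alpha> * cosh \<beta> + 2 * (sinh \<alpha> * sinh \<beta>)
         + ((1 + ka\<^sup>2) * cosh \<alpha> - 2 * ka) * ((1 + kb\<^sup>2) * cosh \<beta> - 2 * kb))"
    by (simp add: power2_eq_square algebra_simps)
  hence "(ka * kb)\<^sup>2 * (cosh \<alpha> * cosh \<beta> + sinh \<alpha> * sinh \<beta>)\<^sup>2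
      \<le> (ka * kb)\<^sup>2 * ((cosh \<alpha> * cosh \<beta>) * (cosh \<alpha> * cosh \<beta> + 2 * (sinh \<alpha> * sinh \<beta>)
         + ((1 + ka\<^sup>2) * cosh \<alpha> - 2 * ka) * ((1 + kb\<^sup>2) * cosh \<beta> - 2 * kb)))"
    by (rule mult_left_mono) simp
  thus ?thesis
    unfolding mix ref bound
    by (simp only: power_mult_distrib power2_eq_square mult_ac)
qed

text \<open>Addition formulas turn products of hyperbolic functions of \<open>t * x - t * y\<close>
  and \<open>c * z\<close> into sums, so both \<open>ref_mn\<close> and \<open>bound_mn\<close> have
  this shape.\<close>

lemma expsum_cosh_mult:
  assumes "c = t \<or> c = -t"
  shows "expsum m n (\<lambda>x y z. p * cosh (t * x - t * y + c * z) + q * cosh (t * x - t * y - c * z)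
           + r * cosh (t * x - t * y) + s * cosh (c * z) + l)
    ((p + q) * (exp (n * t\<^sup>2) * exp (m * t\<^sup>2 / 2)) + r * exp (n * t\<^sup>2) + s * exp (m * t\<^sup>2 / 2) + l)"
proof -
  have c: "c\<^sup>2 = t\<^sup>2" using assms by auto
  have "expsum m n (\<lambda>x y z. p * cosh (t * x + (-t) * y + c * z) + q * cosh (t * x + (-t) * y + (-c) * z)
           + r * cosh (t * x + (-t) * y + 0 * z) + s * cosh (0 * x + 0 * y + c * z) + l)
    (p * exp ((n * t\<^sup>2 + n * (-t)\<^sup>2 + m * c\<^sup>2) / 2) + q * exp ((n * t\<^sup>2 + n * (-t)\<^sup>2 + m * (-c)\<^sup>2) / 2)
      + r * exp ((n * t\<^sup>2 + n * (-t)\<^sup>2 + m * (0::real)\<^sup>2) / 2) + s * exp ((n * (0::real)\<^sup>2 + n * (0::real)\<^sup>2 + m * c\<^sup>2) / 2) + l)"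
    by (intro expsum_add expsum_scale expsum_cosh expsum_const)
  moreover have "exp ((n * t\<^sup>2 + n * (-t)\<^sup>2 + m * t\<^sup>2) / 2) = exp (n * t\<^sup>2) * exp (m * t\<^sup>2 / 2)"
    by (simp add: exp_add[symmetric] add_divide_distrib)
  ultimately show ?thesis by (simp add: c algebra_simps)
qed

lemma expsum_ref_mn: "expsum m n (ref_mn m n t) 1"
proof -
  define N where "N = exp (- real n * t\<^sup>2) * exp (- real m * t\<^sup>2 / 2)"
  have "expsum m n (\<lambda>x y z. N/2 * cosh (t * x - t * y + t * z) + N/2 * cosh (t * x - t * y - t * z)
           + 0 * cosh (t * x - t * y) + 0 * cosh (t * z) + 0)
       ((N/2 + N/2) * (exp (n * t\<^sup>2) * exp (m * t\<^sup>2 / 2)) + 0 * exp (n * t\<^sup>2) + 0 * exp (m * t\<^sup>2 / 2) + 0)"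
    by (rule expsum_cosh_mult) simp
  moreover have "N * (exp (n * t\<^sup>2) * exp (m * t\<^sup>2 / 2)) = 1"
    by (simp add: N_def exp_minus field_simps)
  moreover have "N/2 * cosh (t * x - t * y + t * z) + N/2 * cosh (t * x - t * y - t * z) = ref_mn m n t x y z"
    for x y z
    unfolding ref_mn_def N_def[symmetric] cosh_add[of "t * x - t * y"] cosh_diff[of "t * x - t * y" "t * z"]
    by (simp add: algebra_simps)
  ultimately show ?thesis by simp
qed

text \<open>Under zero means \<open>t * x - t * y\<close> and \<open>c * z\<close> are independent,
  their cosh have means 1 / ka and 1 / kb, and the product of their sinh has mean 0. The excess over
  1 is thus a factor from (X, Y) times a factor from Z.\<close>

lemma expsum_bound_mn:
  assumes "c = t \<or> c = -t"
  shows "expsum m n (bound_mn m n t c) (1 + (1 - exp (- 2 * real n * t\<^sup>2)) * (1 - exp (- real m * t\<^sup>2)))"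
proof -
  define ka kb where "ka = exp (- real n * t\<^sup>2)" and "kb = exp (- real m * t\<^sup>2 / 2)"
  have pos: "ka > 0" "kb > 0" by (auto simp: ka_def kb_def)
  have inv: "exp (n * t\<^sup>2) = 1 / ka" "exp (m * t\<^sup>2 / 2) = 1 / kb"
    by (simp_all add: ka_def kb_def exp_minus field_simps)
  have sq: "exp (- 2 * real n * t\<^sup>2) = ka\<^sup>2" "exp (- real m * t\<^sup>2) = kb\<^sup>2"
    by (simp_all add: ka_def kb_def exp_double[symmetric])
  define pp where "pp = (1 + ka\<^sup>2) * (1 + kb\<^sup>2)"
  \<comment> \<open>The product of the cosh is half the sum, and the product of the sinh half the
    difference, of cosh at the sum and cosh at the difference; collecting terms gives these
    coefficients.\<close>
  define f where "f = (\<lambda>x y z. (ka * kb * (3 + pp) / 2) * cosh (t * x - t * y + c * z) + (ka * kb * (pp - 1) / 2) * cosh (t * x - t * y - c * z)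
           + (- ka * kb * (1 + ka\<^sup>2) * (2 * kb)) * cosh (t * x - t * y) + (- ka * kb * (1 + kb\<^sup>2) * (2 * ka)) * cosh (c * z) + 4 * (ka * kb)\<^sup>2)"
  have "expsum m n f
       (((ka * kb * (3 + pp) / 2) + (ka * kb * (pp - 1) / 2)) * (exp (n * t\<^sup>2) * exp (m * t\<^sup>2 / 2))
        + (- ka * kb * (1 + ka\<^sup>2) * (2 * kb)) * exp (n * t\<^sup>2) + (- ka * kb * (1 + kb\<^sup>2) * (2 * ka)) * exp (m * t\<^sup>2 / 2) + 4 * (ka * kb)\<^sup>2)"
    unfolding f_def by (rule expsum_cosh_mult) fact
  also have "((ka * kb * (3 + pp) / 2) + (ka * kb * (pp - 1) / 2)) * (exp (n * t\<^sup>2) * exp (m * t\<^sup>2 / 2))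
        + (- ka * kb * (1 + ka\<^sup>2) * (2 * kb)) * exp (n * t\<^sup>2) + (- ka * kb * (1 + kb\<^sup>2) * (2 * ka)) * exp (m * t\<^sup>2 / 2) + 4 * (ka * kb)\<^sup>2
       = 1 + (1 - ka\<^sup>2) * (1 - kb\<^sup>2)"
    unfolding inv pp_def using pos by (simp add: field_simps power2_eq_square)
  also have "f = bound_mn m n t c"
  proof (intro ext)
    fix x y z
    define \<alpha> \<beta> where "\<alpha> = t * x - t * y" and "\<beta> = c * z"
    have "bound_mn m n t c x y z = ka * kb * (cosh \<alpha> * cosh \<beta> + 2 * (sinh \<alpha> * sinh \<beta>)
         + ((1 + ka\<^sup>2) * cosh \<alpha> - 2 * ka) * ((1 + kb\<^sup>2) * cosh \<beta> - 2 * kb))"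
      by (simp add: bound_mn_def ka_def kb_def \<alpha>_def \<beta>_def)
    thus "f x y z = bound_mn m n t c x y z"
      unfolding f_def pp_def \<alpha>_def[symmetric] \<beta>_def[symmetric]
      unfolding cosh_add cosh_diff
      by (simp add: field_simps power2_eq_square)
  qed
  finally show ?thesis unfolding sq .
qed

text \<open>After mixing, (X, Y) alone and Z alone have laws that do not depend on the hypothesis;
  only their dependence reveals it. Since 1 - exp (-s) is at most s, coordinate i contributes at
  most 2 n x_i^2 * m x_i^2.\<close>

lemma mixture_bound_mn:
  fixes x :: "real^'d"
  assumes \<phi>m [measurable]: "\<phi> \<in> borel_measurable (lfht_data m n 0 0 0)"
    and \<phi>: "\<And>\<omega>. 0 \<le> \<phi> \<omega>" "\<And>\<omega>. \<phi> \<omega> \<le> 1"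
    and e0: "\<And>\<xi>. \<xi> \<in> signs \<Longrightarrow>
      (\<integral>\<omega>. \<phi> \<omega> * lik m n (flip \<xi> x) (flip \<xi> (-x)) (flip \<xi> x) \<omega> \<partial>lfht_data m n 0 0 0) \<le> 1/4"
    and e1: "\<And>\<xi>. \<xi> \<in> signs \<Longrightarrow>
      (\<integral>\<omega>. (1 - \<phi> \<omega>) * lik m n (flip \<xi> x) (flip \<xi> (-x)) (flip \<xi> (-x)) \<omega> \<partial>lfht_data m n 0 0 0) \<le> 1/4"
  shows "real m * real n * (\<Sum>i\<in>UNIV. (x $ i) ^ 4) \<ge> 1/10"
proof -
  let ?e = "\<lambda>i. 1 + (1 - exp (- 2 * real n * (x $ i)\<^sup>2)) * (1 - exp (- real m * (x $ i)\<^sup>2))"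
  have e: "0 \<le> ?e i" "?e i \<le> exp (2 * n * (x $ i)\<^sup>2 * (m * (x $ i)\<^sup>2))" for i
  proof -
    have b: "0 \<le> 1 - exp (- s)" "1 - exp (- s) \<le> s" if "s \<ge> 0" for s :: real
      using that exp_ge_add_one_self[of "-s"] by auto
    have 1: "0 \<le> 1 - exp (- (2 * n * (x $ i)\<^sup>2))" "1 - exp (- (2 * n * (x $ i)\<^sup>2)) \<le> 2 * n * (x $ i)\<^sup>2"
      by (rule b; simp)+
    have 2: "0 \<le> 1 - exp (- (m * (x $ i)\<^sup>2))" "1 - exp (- (m * (x $ i)\<^sup>2)) \<le> m * (x $ i)\<^sup>2"
      by (rule b; simp)+
    show "0 \<le> ?e i" using mult_nonneg_nonneg[OF 1(1) 2(1)] by simp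
    have "?e i \<le> 1 + 2 * n * (x $ i)\<^sup>2 * (m * (x $ i)\<^sup>2)"
      using mult_mono[OF 1(2) 2(2) _ 2(1)] by simp
    also have "\<dots> \<le> exp (2 * n * (x $ i)\<^sup>2 * (m * (x $ i)\<^sup>2))" by (rule exp_ge_add_one_self)
    finally show "?e i \<le> exp (2 * n * (x $ i)\<^sup>2 * (m * (x $ i)\<^sup>2))" .
  qed
  have "(\<Sum>i\<in>UNIV. 2 * n * (x $ i)\<^sup>2 * (m * (x $ i)\<^sup>2)) \<ge> 1/5"
  proof (rule chi_square_ge_of_mixture_test[OF \<phi>m \<phi> e0 e1])
    show "(mix m n (x $ i) ((- x) $ i) (x $ i) x' y z)\<^sup>2
        \<le> ref_mn m n (x $ i) x' y z * bound_mn m n (x $ i) (x $ i) x' y z" for i x' y z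
      using mix_square_le_bound_mn[of "x $ i" "x $ i"] by simp
    show "(mix m n (x $ i) ((- x) $ i) ((- x) $ i) x' y z)\<^sup>2
        \<le> ref_mn m n (x $ i) x' y z * bound_mn m n (x $ i) (- x $ i) x' y z" for i x' y z
      using mix_square_le_bound_mn[of "- x $ i" "x $ i"] by simp
    show "0 < ref_mn m n (x $ i) x' y z" for i x' y z
      by (auto simp: ref_mn_def cosh_real_pos)
    show "0 \<le> ?e i" "?e i \<le> exp (2 * n * (x $ i)\<^sup>2 * (m * (x $ i)\<^sup>2))" for i by (fact e)+
    show "expsum m n (bound_mn m n (x $ i) (x $ i)) (?e i)"
      "expsum m n (bound_mn m n (x $ i) (- x $ i)) (?e i)" for i
      by (rule expsum_bound_mn; simp)+
  qed (auto intro: expsum_ref_mn)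
  also have "(\<Sum>i\<in>UNIV. 2 * n * (x $ i)\<^sup>2 * (m * (x $ i)\<^sup>2)) = 2 * (real m * real n * (\<Sum>i\<in>UNIV. (x $ i) ^ 4))"
    by (simp add: sum_distrib_left power4_eq_xxxx power2_eq_square mult_ac)
  finally show ?thesis by simp
qed

subsection \<open>Orthosymmetric convex sets\<close>

lemma orthosymmetric_flip:
  assumes "orthosymmetric \<Gamma>" "x \<in> \<Gamma>" "\<xi> \<in> signs"
  shows "flip \<xi> x \<in> \<Gamma>"
proof -
  have "\<xi> i \<in> {-1, 1}" for i using assms(3) unfolding signs_def by (rule PiE_mem) simp
  hence *: "flip \<xi> x = (\<chi> i. if i \<in> {i. \<xi> i = -1} then - (x $ i) else x $ i)"
    by (auto simp: flip_def vec_eq_iff)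
  show ?thesis using assms unfolding * orthosymmetric_def by blast
qed

text \<open>Coordinates are replaced one at a time: a number of modulus at most that of
  \<open>\<theta> $ j\<close> is a convex combination of \<open>\<theta> $ j\<close> and its
  negative.\<close>

lemma orthosymmetric_convex_solid:
  fixes \<Gamma> :: "(real^'d) set"
  assumes "orthosymmetric \<Gamma>" "convex \<Gamma>" "\<theta> \<in> \<Gamma>" "\<And>i. \<bar>x $ i\<bar> \<le> \<bar>\<theta> $ i\<bar>"
  shows "x \<in> \<Gamma>"
proof -
  have "(\<chi> i. if i \<in> S then x $ i else \<theta> $ i) \<in> \<Gamma>" for S
    using finite[of S]
  proof (induction S rule: finite_induct)
    case empty
    show ?case using assms(3) by simp
  next
    case (insert j S)
    define y where "y = (\<chi> i. if i \<in> S then x $ i else \<theta> $ i)"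
    define y' where "y' = (\<chi> i. if i \<in> {j} then - (y $ i) else y $ i)"
    have y: "y \<in> \<Gamma>" "y' \<in> \<Gamma>"
      using insert.IH assms(1) unfolding y_def y'_def orthosymmetric_def by blast+
    \<comment> \<open>The weight solves l * \<open>\<theta> $ j\<close> - (1 - l) *
      \<open>\<theta> $ j\<close> = \<open>x $ j\<close>; if \<open>\<theta> $ j\<close> is 0, so is
      \<open>x $ j\<close>, and any weight would do.\<close>
    define l where "l = (if \<theta> $ j = 0 then 1 else (1 + x $ j / \<theta> $ j) / 2)"
    have b: "\<bar>x $ j / \<theta> $ j\<bar> \<le> 1" if "\<theta> $ j \<noteq> 0"
      using assms(4)[of j] that by (simp add: abs_divide)
    have l: "0 \<le> l" "l \<le> 1"
      using b by (auto simp: l_def simp del: abs_divide)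
    have "l *\<^sub>R y + (1 - l) *\<^sub>R y' \<in> \<Gamma>"
      using assms(2) y l by (intro convexD) auto
    also have "l *\<^sub>R y + (1 - l) *\<^sub>R y' = (\<chi> i. if i \<in> insert j S then x $ i else \<theta> $ i)"
    proof -
      have "l * \<theta> $ j - (1 - l) * \<theta> $ j = x $ j"
        using assms(4)[of j] by (auto simp: l_def field_simps)
      thus ?thesis using insert.hyps by (auto simp: vec_eq_iff y_def y'_def algebra_simps)
    qed
    finally show ?case .
  qed
  from this[of UNIV] show ?thesis by simp
qed

section \<open>Two-point tests\<close>

lemma two_point_bounds:
  fixes \<Gamma> :: "(real^'d) set"
  assumes \<Gamma>: "orthosymmetric \<Gamma>" "convex \<Gamma>" and \<epsilon>: "\<epsilon> > 0"
    and ex: "\<exists>\<theta>1\<in>\<Gamma>. \<exists>\<theta>2\<in>\<Gamma>. dist \<theta>1 \<theta>2 \<ge> \<epsilon>"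
    and feas: "lfht_feasible \<Gamma> \<epsilon> m n"
  shows "real m * \<epsilon>\<^sup>2 \<ge> 1" "real n * \<epsilon>\<^sup>2 \<ge> 1/2"
proof -
  from ex obtain \<theta>1 \<theta>2 where \<theta>: "\<theta>1 \<in> \<Gamma>" "\<theta>2 \<in> \<Gamma>" "dist \<theta>1 \<theta>2 \<ge> \<epsilon>" by blast
  have neg: "- y \<in> \<Gamma>" if "y \<in> \<Gamma>" for y
    by (rule orthosymmetric_convex_solid[OF \<Gamma> that]) simp
  \<comment> \<open>Symmetry and convexity put half the difference of two points into
    \<open>\<Gamma>\<close>; shrinking it makes the distance of x and -x exactly
    \<open>\<epsilon>\<close>.\<close>
  have "(1/2) *\<^sub>R \<theta>1 + (1/2) *\<^sub>R (- \<theta>2) \<in> \<Gamma>"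
    using \<Gamma>(2) \<theta> neg by (intro convexD) auto
  hence h: "(1/2) *\<^sub>R (\<theta>1 - \<theta>2) \<in> \<Gamma>" by (simp add: scaleR_diff_right)
  define t where "t = \<epsilon> / dist \<theta>1 \<theta>2"
  have t: "0 \<le> t" "t \<le> 1" "t * dist \<theta>1 \<theta>2 = \<epsilon>"
    using \<theta>(3) \<epsilon> less_le_trans[OF \<epsilon> \<theta>(3)] by (auto simp: t_def divide_le_eq)
  define x where "x = t *\<^sub>R ((1/2) *\<^sub>R (\<theta>1 - \<theta>2))"
  have x: "x \<in> \<Gamma>"
    by (rule orthosymmetric_convex_solid[OF \<Gamma> h]) (use t in \<open>auto simp: x_def abs_mult intro!: mult_left_le_one_le\<close>)
  have nx: "norm (2 *\<^sub>R x) = \<epsilon>" using t by (simp add: x_def dist_norm)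
  have d: "dist x (-x) \<ge> \<epsilon>" "dist (-x) x \<ge> \<epsilon>"
    using nx by (auto simp: dist_norm scaleR_2 norm_minus_commute)
  obtain \<phi> where
    \<phi>: "\<phi> \<in> borel_measurable (lfht_data m n 0 0 0)" "\<And>\<omega>. 0 \<le> \<phi> \<omega>" "\<And>\<omega>. \<phi> \<omega> \<le> 1"
    and e0: "\<And>\<theta>1 \<theta>2. \<theta>1 \<in> \<Gamma> \<Longrightarrow> \<theta>2 \<in> \<Gamma> \<Longrightarrow> dist \<theta>1 \<theta>2 \<ge> \<epsilon> \<Longrightarrow>
       (\<integral>\<omega>. \<phi> \<omega> * lik m n \<theta>1 \<theta>2 \<theta>1 \<omega> \<partial>lfht_data m n 0 0 0) \<le> 1/4"
    and e1: "\<And>\<theta>1 \<theta>2. \<theta>1 \<in> \<Gamma> \<Longrightarrow> \<theta>2 \<in> \<Gamma> \<Longrightarrow> dist \<theta>1 \<theta>2 \<ge> \<epsilon> \<Longrightarrow>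
       (\<integral>\<omega>. (1 - \<phi> \<omega>) * lik m n \<theta>1 \<theta>2 \<theta>2 \<omega> \<partial>lfht_data m n 0 0 0) \<le> 1/4"
    by (rule test_of_lfht_feasible[OF feas], rule that)
  \<comment> \<open>The affinity is exp (-q / 8) with q the left-hand side, and its square is at
    most 3/4; but q < 1 would give exp (-q / 4) \<ge> 1 - q / 4 > 3/4.\<close>
  have bc: "(n * (norm (a - a'))\<^sup>2 + n * (norm (b - b'))\<^sup>2 + m * (norm (c - c'))\<^sup>2) \<ge> 1"
    if "(\<integral>\<omega>. \<phi> \<omega> * lik m n a b c \<omega> \<partial>lfht_data m n 0 0 0) \<le> 1/4"
       "(\<integral>\<omega>. (1 - \<phi> \<omega>) * lik m n a' b' c' \<omega> \<partial>lfht_data m n 0 0 0) \<le> 1/4" for a b c a' b' c'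
  proof (rule ccontr)
    define q where "q = n * (norm (a - a'))\<^sup>2 + n * (norm (b - b'))\<^sup>2 + m * (norm (c - c'))\<^sup>2"
    assume "\<not> ?thesis"
    hence q: "q < 1" by (simp add: q_def)
    have "exp (- q / 8) \<le> sqrt 3 / 2"
      using bhattacharyya_le_of_test[OF \<phi> has_bochner_integral_lik _ has_bochner_integral_lik _ that]
        has_bochner_integral_sqrt_lik[of m n a b c a' b' c']
      by (simp add: has_bochner_integral_iff lik_def q_def)
    hence "(exp (- q / 8))\<^sup>2 \<le> (sqrt 3 / 2)\<^sup>2" by (intro power_mono) auto
    hence "exp (- q / 4) \<le> 3/4" by (simp add: exp_double[symmetric] power_divide)
    with exp_ge_add_one_self[of "- q / 4"] q show False by simp
  qed
  have "- x - x = - (2 *\<^sub>R x)" "x - - x = 2 *\<^sub>R x" by (simp_all add: scaleR_2)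
  hence nn: "norm (- x - x) = \<epsilon>" "norm (x - - x) = \<epsilon>"
    using nx by (simp_all only: norm_minus_cancel)
  \<comment> \<open>Both hypotheses use the pair (x, -x), so only the mean of Z moves, by
    \<open>\<epsilon>\<close>.\<close>
  show "real m * \<epsilon>\<^sup>2 \<ge> 1"
    using bc[OF e0[OF x neg[OF x] d(1)] e1[OF x neg[OF x] d(1)]] unfolding nn by simp
  \<comment> \<open>The pair is swapped so that Z has mean x in both cases; the means of X and Y
    each move by \<open>\<epsilon>\<close>.\<close>
  show "real n * \<epsilon>\<^sup>2 \<ge> 1/2"
    using bc[OF e0[OF x neg[OF x] d(1)] e1[OF neg[OF x] x d(2)]] unfolding nn by simp
qed

subsection \<open>Risk of soft thresholding\<close>

text \<open>For t \<ge> 0 this is sign y * max 0 (|y| - t), written as a difference of positive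
  parts.\<close>

definition soft :: "real \<Rightarrow> real \<Rightarrow> real" where
  "soft t y = max 0 (y - t) - max 0 (- y - t)"

lemma borel_measurable_soft [measurable]: "soft t \<in> borel_measurable borel"
  unfolding soft_def[abs_def] by measurable

text \<open>Soft thresholding is 1-Lipschitz, so moving z into [-t, t] costs the last term. For such
  z the estimate lies between 0 and \<open>\<theta>\<close> and within 2 t of
  \<open>\<theta>\<close>.\<close>

lemma soft_error_le:
  assumes "t \<ge> 0"
  shows "\<bar>soft t (\<theta> + z) - \<theta>\<bar> \<le> min \<bar>\<theta>\<bar> (2 * t) + max 0 (\<bar>z\<bar> - t)"
  using assms unfolding soft_def by (auto simp: max_def min_def abs_if)

text \<open>The overshoot b of the noise beyond t is traded for exponentials by (l b)^2 / 2 \<le>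
  exp (l b), since their means are known.\<close>

lemma soft_error_square_le:
  assumes "t \<ge> 0" "l > 0"
  shows "(soft t (\<theta> + z) - \<theta>)\<^sup>2 \<le> 3/2 * min (\<theta>\<^sup>2) (4 * t\<^sup>2)
     + 6 / l\<^sup>2 * exp (- l * t) * (exp (l * z) + exp (- l * z))"
proof -
  define a b where "a = min \<bar>\<theta>\<bar> (2 * t)" and "b = max 0 (\<bar>z\<bar> - t)"
  have ab: "0 \<le> a" "0 \<le> b" using assms by (auto simp: a_def b_def)
  have a2: "a\<^sup>2 = min (\<theta>\<^sup>2) (4 * t\<^sup>2)"
  proof (cases "\<bar>\<theta>\<bar> \<le> 2 * t")
    case True
    hence "\<bar>\<theta>\<bar>\<^sup>2 \<le> (2 * t)\<^sup>2" by (intro power_mono) auto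
    with True show ?thesis by (simp add: a_def power_mult_distrib)
  next
    case False
    hence "(2 * t)\<^sup>2 \<le> \<bar>\<theta>\<bar>\<^sup>2" using assms by (intro power_mono) auto
    with False show ?thesis by (simp add: a_def power_mult_distrib)
  qed
  have b2: "b\<^sup>2 \<le> 2 / l\<^sup>2 * exp (- l * t) * (exp (l * z) + exp (- l * z))"
  proof (cases "\<bar>z\<bar> \<le> t")
    case True
    thus ?thesis by (simp add: b_def)
  next
    case False
    have "(l * b)\<^sup>2 / 2 \<le> exp (l * b)"
      using exp_lower_Taylor_quadratic[of "l * b"] mult_nonneg_nonneg[of l b] assms ab by linarith
    also have "\<dots> = exp (- l * t) * exp (l * \<bar>z\<bar>)"
      using False by (simp add: b_def exp_add[symmetric] algebra_simps)
    also have "\<dots> \<le> exp (- l * t) * (exp (l * z) + exp (- l * z))"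
      by (intro mult_left_mono) (auto simp: abs_if)
    finally show ?thesis using assms by (simp add: field_simps)
  qed
  have "(soft t (\<theta> + z) - \<theta>)\<^sup>2 \<le> (a + b)\<^sup>2"
    using soft_error_le[OF assms(1), of \<theta> z] ab unfolding a_def[symmetric] b_def[symmetric]
    by (metis abs_ge_zero power2_abs power_mono)
  also have "\<dots> \<le> 3/2 * a\<^sup>2 + 3 * b\<^sup>2"
    \<comment> \<open>2 a b \<le> a^2 / 2 + 2 b^2. The weight 3/2 on the main term stays below the 2
      in the squared target risk 2 \<open>\<epsilon>\<close>^2.\<close>
    using zero_le_power2[of "a - 2 * b"] by (simp add: power2_eq_square algebra_simps)
  also have "\<dots> \<le> 3/2 * a\<^sup>2 + 3 * (2 / l\<^sup>2 * exp (- l * t) * (exp (l * z) + exp (- l * z)))"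
    using b2 by (intro add_left_mono mult_left_mono) auto
  finally show ?thesis by (simp add: a2)
qed

text \<open>The exponential times the density at \<open>\<theta>\<close> is a constant times the
  density at \<open>v + \<theta>\<close>, which integrates to 1.\<close>

lemma nn_integral_samples_exp:
  fixes v \<theta> :: "real^'d"
  shows "(\<integral>\<^sup>+ X. ennreal (exp (v \<bullet> (sample_sum k X - real k *\<^sub>R \<theta>))) \<partial>samples k \<theta>) = ennreal (exp (k * (norm v)\<^sup>2 / 2))"
proof -
  let ?f = "\<lambda>\<theta> X. ennreal (exp (\<theta> \<bullet> sample_sum k X - k * (norm \<theta>)\<^sup>2 / 2))"
  have one: "(\<integral>\<^sup>+ X. ?f \<theta> X \<partial>samples k 0) = 1" for \<theta> :: "real^'d"
  proof -
    interpret prob_space "samples k \<theta>" by (rule prob_space_samples)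
    show ?thesis
      using emeasure_space_1 unfolding samples_density[of k \<theta>] by (simp add: emeasure_density)
  qed
  have "(\<integral>\<^sup>+ X. ennreal (exp (v \<bullet> (sample_sum k X - real k *\<^sub>R \<theta>))) \<partial>samples k \<theta>)
     = (\<integral>\<^sup>+ X. ?f \<theta> X * ennreal (exp (v \<bullet> (sample_sum k X - real k *\<^sub>R \<theta>))) \<partial>samples k 0)"
    unfolding samples_density[of k \<theta>] by (rule nn_integral_density) auto
  also have "\<dots> = (\<integral>\<^sup>+ X. ennreal (exp (k * (norm v)\<^sup>2 / 2)) * ?f (v + \<theta>) X \<partial>samples k 0)"
  proof (intro nn_integral_cong)
    fix X :: "nat \<Rightarrow> real^'d"
    have "(norm (v + \<theta>))\<^sup>2 = (norm v)\<^sup>2 + 2 * (v \<bullet> \<theta>) + (norm \<theta>)\<^sup>2"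
      unfolding power2_norm_eq_inner by (simp add: inner_add_left inner_add_right inner_commute)
    thus "?f \<theta> X * ennreal (exp (v \<bullet> (sample_sum k X - real k *\<^sub>R \<theta>)))
        = ennreal (exp (k * (norm v)\<^sup>2 / 2)) * ?f (v + \<theta>) X"
      by (simp add: ennreal_mult[symmetric] exp_add[symmetric] inner_add_left inner_diff_right
          algebra_simps add_divide_distrib)
  qed
  also have "\<dots> = ennreal (exp (k * (norm v)\<^sup>2 / 2))"
    by (subst nn_integral_cmult) (auto simp: one)
  finally show ?thesis .
qed

lemma soft_threshold_risk:
  fixes \<theta> :: "real^'d" and k :: nat and L :: real
  assumes k: "k > 0"
  defines "L \<equiv> ln (4 * real CARD('d))"
  shows "(\<integral>\<^sup>+ X. ennreal ((norm ((\<chi> i. soft (sqrt (2 * L / k)) ((sample_sum k X $ i) / k)) - \<theta>))\<^sup>2) \<partial>samples k \<theta>)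
     \<le> ennreal (3/2 * (\<Sum>i\<in>UNIV. min ((\<theta> $ i)\<^sup>2) (8 * L / k)) + 3 / (2 * k * L))"
proof -
  define t where "t = sqrt (2 * L / k)"
  \<comment> \<open>Noise in a coordinate of the mean has variance 1 / k, so l = t k minimises exp
    (l^2 / (2 k) - l t).\<close>
  define l where "l = t * k"
  have L: "L > 0" unfolding L_def by (rule ln_gt_zero) (use zero_less_card_finite[where 'a='d] in linarith)
  have t: "t > 0" "t\<^sup>2 = 2 * L / k" using L k by (auto simp: t_def)
  have l: "l > 0" "l\<^sup>2 = 2 * L * k" "l * t = 2 * L"
    using t k by (auto simp: l_def power_mult_distrib power2_eq_square field_simps)
  define S where "S = (\<Sum>i\<in>UNIV. min ((\<theta> $ i)\<^sup>2) (8 * L / k))"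
  define Z where "Z X = sample_sum k X - real k *\<^sub>R \<theta>" for X
  define c where "c = 6 / l\<^sup>2 * exp (- l * t)"
  have pt: "(norm ((\<chi> i. soft t ((sample_sum k X $ i) / k)) - \<theta>))\<^sup>2
      \<le> 3/2 * S + (\<Sum>i\<in>UNIV. c * exp (axis i t \<bullet> Z X) + c * exp (axis i (-t) \<bullet> Z X))" for X
  proof -
    have "(norm ((\<chi> i. soft t ((sample_sum k X $ i) / k)) - \<theta>))\<^sup>2
       = (\<Sum>i\<in>UNIV. (soft t (\<theta> $ i + (Z X $ i) / k) - \<theta> $ i)\<^sup>2)"
      using k unfolding norm_square_vec by (simp add: Z_def diff_divide_distrib)
    also have "\<dots> \<le> (\<Sum>i\<in>UNIV. 3/2 * min ((\<theta> $ i)\<^sup>2) (4 * t\<^sup>2)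
         + c * (exp (l * (Z X $ i / k)) + exp (- l * (Z X $ i / k))))"
      unfolding c_def using t l by (intro sum_mono soft_error_square_le) auto
    also have "\<dots> = 3/2 * S + (\<Sum>i\<in>UNIV. c * exp (axis i t \<bullet> Z X) + c * exp (axis i (-t) \<bullet> Z X))"
    proof -
      have "c * (exp (l * (Z X $ i / k)) + exp (- l * (Z X $ i / k)))
         = c * exp (axis i t \<bullet> Z X) + c * exp (axis i (-t) \<bullet> Z X)" for i
        using k by (simp add: inner_axis' l_def distrib_left)
      moreover have "4 * t\<^sup>2 = 8 * L / k" by (simp add: t(2))
      ultimately show ?thesis by (simp only: sum.distrib S_def sum_distrib_left)
    qed
    finally show ?thesis .
  qed
  have [measurable]: "Z \<in> borel_measurable (samples k \<theta>)"
    unfolding Z_def[abs_def] by measurable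
  interpret prob_space "samples k \<theta>" by (rule prob_space_samples)
  have S0: "S \<ge> 0" unfolding S_def using L by (intro sum_nonneg) auto
  have c0: "c \<ge> 0" by (simp add: c_def)
  have mgf: "(\<integral>\<^sup>+ X. ennreal (c * exp (axis i s \<bullet> Z X)) \<partial>samples k \<theta>) = ennreal (c * exp L)"
    if "s\<^sup>2 = t\<^sup>2" for i s
  proof -
    have "(\<integral>\<^sup>+ X. ennreal (c * exp (axis i s \<bullet> Z X)) \<partial>samples k \<theta>)
      = ennreal c * (\<integral>\<^sup>+ X. ennreal (exp (axis i s \<bullet> Z X)) \<partial>samples k \<theta>)"
      unfolding ennreal_mult[OF c0 exp_ge_zero] by (rule nn_integral_cmult) simp
    also have "\<dots> = ennreal c * ennreal (exp (k * (norm (axis i s))\<^sup>2 / 2))"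
      unfolding Z_def nn_integral_samples_exp ..
    also have "k * (norm (axis i s))\<^sup>2 / 2 = L"
      using that t k unfolding power2_norm_eq_inner by (simp add: inner_axis_axis power2_eq_square)
    finally show ?thesis unfolding ennreal_mult[OF c0 exp_ge_zero] .
  qed
  have "(\<integral>\<^sup>+ X. ennreal ((norm ((\<chi> i. soft t ((sample_sum k X $ i) / k)) - \<theta>))\<^sup>2) \<partial>samples k \<theta>)
     \<le> (\<integral>\<^sup>+ X. ennreal (3/2 * S) + (\<Sum>i\<in>UNIV. ennreal (c * exp (axis i t \<bullet> Z X)) + ennreal (c * exp (axis i (-t) \<bullet> Z X))) \<partial>samples k \<theta>)"
  proof (intro nn_integral_mono)
    fix X
    have "ennreal ((norm ((\<chi> i. soft t ((sample_sum k X $ i) / k)) - \<theta>))\<^sup>2)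
       \<le> ennreal (3/2 * S + (\<Sum>i\<in>UNIV. c * exp (axis i t \<bullet> Z X) + c * exp (axis i (-t) \<bullet> Z X)))"
      using pt by (rule ennreal_leI)
    also have "\<dots> = ennreal (3/2 * S) + (\<Sum>i\<in>UNIV. ennreal (c * exp (axis i t \<bullet> Z X)) + ennreal (c * exp (axis i (-t) \<bullet> Z X)))"
      using S0 c0 by (subst ennreal_plus) (auto intro!: sum_nonneg simp: sum_ennreal[symmetric])
    finally show "ennreal ((norm ((\<chi> i. soft t ((sample_sum k X $ i) / k)) - \<theta>))\<^sup>2) \<le> \<dots>" .
  qed
  also have "\<dots> = ennreal (3/2 * S) + (\<Sum>i\<in>(UNIV :: 'd set). ennreal (c * exp L) + ennreal (c * exp L))"
    by (simp add: nn_integral_add nn_integral_sum mgf emeasure_space_1)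
  also have "\<dots> = ennreal (3/2 * S + CARD('d) * (2 * (c * exp L)))"
    using S0 c0 by (simp add: ennreal_plus[symmetric] ennreal_mult[symmetric] ennreal_of_nat_eq_real_of_nat del: ennreal_plus)
  \<comment> \<open>Here exp (-l t) * exp L = exp (-L) = 1 / (4 D), which cancels the number of
    coordinates: this is what fixes L = ln (4 D).\<close>
  also have "CARD('d) * (2 * (c * exp L)) = 3 / (2 * k * L)"
  proof -
    have eL: "exp L = 4 * CARD('d)" unfolding L_def by simp
    have "exp (- l * t) = 1 / (exp L)\<^sup>2" by (simp add: l(3) exp_minus exp_double[symmetric] field_simps)
    thus ?thesis unfolding c_def l(2) eL using L k by (simp add: power2_eq_square field_simps)
  qed
  finally show ?thesis unfolding t_def S_def .
qed

subsection \<open>Sample size bounds\<close>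

text \<open>The sum of x_i^4 is at most the largest x_i^2 times |x|^2, hence at most c
  \<open>\<epsilon>\<close>^2; solidity and orthosymmetry keep all randomised means inside
  \<open>\<Gamma>\<close>.\<close>

lemma mixture_bounds:
  fixes \<Gamma> :: "(real^'d) set"
  assumes \<Gamma>: "orthosymmetric \<Gamma>" "convex \<Gamma>" and \<epsilon>: "\<epsilon> > 0"
    and feas: "lfht_feasible \<Gamma> \<epsilon> m n"
    and x: "x \<in> \<Gamma>" "norm x = \<epsilon>" "\<And>i. (x $ i)\<^sup>2 \<le> c"
  shows "(real n)\<^sup>2 * (c * \<epsilon>\<^sup>2) \<ge> 2/5" "real m * real n * (c * \<epsilon>\<^sup>2) \<ge> 1/10"
proof -
  obtain \<phi> where
    \<phi>: "\<phi> \<in> borel_measurable (lfht_data m n 0 0 0)" "\<And>\<omega>. 0 \<le> \<phi> \<omega>" "\<And>\<omega>. \<phi> \<omega> \<le> 1"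
    and e0: "\<And>\<theta>1 \<theta>2. \<theta>1 \<in> \<Gamma> \<Longrightarrow> \<theta>2 \<in> \<Gamma> \<Longrightarrow> dist \<theta>1 \<theta>2 \<ge> \<epsilon> \<Longrightarrow>
       (\<integral>\<omega>. \<phi> \<omega> * lik m n \<theta>1 \<theta>2 \<theta>1 \<omega> \<partial>lfht_data m n 0 0 0) \<le> 1/4"
    and e1: "\<And>\<theta>1 \<theta>2. \<theta>1 \<in> \<Gamma> \<Longrightarrow> \<theta>2 \<in> \<Gamma> \<Longrightarrow> dist \<theta>1 \<theta>2 \<ge> \<epsilon> \<Longrightarrow>
       (\<integral>\<omega>. (1 - \<phi> \<omega>) * lik m n \<theta>1 \<theta>2 \<theta>2 \<omega> \<partial>lfht_data m n 0 0 0) \<le> 1/4"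
    by (rule test_of_lfht_feasible[OF feas], rule that)
  have mem: "0 \<in> \<Gamma>" "- x \<in> \<Gamma>"
    by (rule orthosymmetric_convex_solid[OF \<Gamma> x(1)]; simp)+
  have fl: "flip \<xi> x \<in> \<Gamma>" "flip \<xi> (- x) \<in> \<Gamma>" if "\<xi> \<in> signs" for \<xi>
    using orthosymmetric_flip[OF \<Gamma>(1) _ that] x(1) mem by auto
  have "dist (flip \<xi> x) (flip \<xi> (- x)) = 2 * \<epsilon>" if "\<xi> \<in> signs" for \<xi>
  proof -
    have "dist (flip \<xi> x) (flip \<xi> (- x)) = norm (x - - x)"
      unfolding dist_norm flip_diff norm_flip[OF that] ..
    also have "x - - x = 2 *\<^sub>R x" by (simp add: scaleR_2)
    finally show ?thesis using x(2) by simp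
  qed
  hence d: "dist (flip \<xi> x) (flip \<xi> (- x)) \<ge> \<epsilon>" if "\<xi> \<in> signs" for \<xi>
    using that \<epsilon> by simp
  have d0: "dist 0 (flip \<xi> x) \<ge> \<epsilon>" "dist (flip \<xi> x) 0 \<ge> \<epsilon>" if "\<xi> \<in> signs" for \<xi>
    using norm_flip[OF that, of x] x(2) by auto
  have "(\<Sum>i\<in>UNIV. (x $ i) ^ 4) \<le> (\<Sum>i\<in>UNIV. c * (x $ i)\<^sup>2)"
  proof (rule sum_mono)
    fix i
    have "(x $ i) ^ 4 = (x $ i)\<^sup>2 * (x $ i)\<^sup>2" by (simp add: power_add[symmetric])
    also have "\<dots> \<le> c * (x $ i)\<^sup>2" using x(3) by (intro mult_right_mono) auto
    finally show "(x $ i) ^ 4 \<le> c * (x $ i)\<^sup>2" .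
  qed
  also have "\<dots> = c * \<epsilon>\<^sup>2" by (simp add: sum_distrib_left[symmetric] norm_square_vec[symmetric] x(2))
  finally have s: "(\<Sum>i\<in>UNIV. (x $ i) ^ 4) \<le> c * \<epsilon>\<^sup>2" .
  have "(real n)\<^sup>2 * (\<Sum>i\<in>UNIV. (x $ i) ^ 4) \<ge> 2/5"
    using fl mem d0 by (intro mixture_bound_n[OF \<phi>] e0 e1) auto
  also have "(real n)\<^sup>2 * (\<Sum>i\<in>UNIV. (x $ i) ^ 4) \<le> (real n)\<^sup>2 * (c * \<epsilon>\<^sup>2)"
    using s by (rule mult_left_mono) simp
  finally show "(real n)\<^sup>2 * (c * \<epsilon>\<^sup>2) \<ge> 2/5" .
  have "real m * real n * (\<Sum>i\<in>UNIV. (x $ i) ^ 4) \<ge> 1/10"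
    using fl d by (intro mixture_bound_mn[OF \<phi>] e0 e1) auto
  also have "real m * real n * (\<Sum>i\<in>UNIV. (x $ i) ^ 4) \<le> real m * real n * (c * \<epsilon>\<^sup>2)"
    using s by (rule mult_left_mono) simp
  finally show "real m * real n * (c * \<epsilon>\<^sup>2) \<ge> 1/10" .
qed

text \<open>Soft thresholding with k samples must fail at some \<open>\<theta>\<close> in
  \<open>\<Gamma>\<close>, and there the truncated squares add up to more than
  \<open>\<epsilon>\<close>^2. Truncating and rescaling \<open>\<theta>\<close> gives x.\<close>

lemma ex_spread_vector:
  fixes \<Gamma> :: "(real^'d) set" and L :: real
  assumes \<Gamma>: "orthosymmetric \<Gamma>" "convex \<Gamma>" and \<epsilon>: "\<epsilon> > 0"
    and k: "k > 0" "k < n_est \<Gamma> (sqrt 2 * \<epsilon>)"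
  defines "L \<equiv> ln (4 * real CARD('d))"
  assumes kL: "3 \<le> k * L * \<epsilon>\<^sup>2"
  shows "\<exists>x\<in>\<Gamma>. norm x = \<epsilon> \<and> (\<forall>i. (x $ i)\<^sup>2 \<le> 8 * L / k)"
proof -
  have L: "L > 0" unfolding L_def by (rule ln_gt_zero) (use zero_less_card_finite[where 'a='d] in linarith)
  define est :: "(nat \<Rightarrow> real^'d) \<Rightarrow> real^'d" where
    "est X = (\<chi> i. soft (sqrt (2 * L / k)) ((sample_sum k X $ i) / k))" for X
  have [measurable]: "(\<lambda>v :: real^'d. v $ i) \<in> borel_measurable borel" for i
    by (intro borel_measurable_continuous_onI continuous_intros)
  have "est \<in> borel_measurable (sample_space k)"
    unfolding borel_measurable_euclidean_space[of est]
    by (auto simp: est_def Basis_vec_def inner_axis)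
  \<comment> \<open>Minimality of \<open>LEAST\<close> excludes every sample size below
    \<open>n_est\<close>.\<close>
  moreover have "\<not> (\<exists>est \<in> borel_measurable (sample_space k).
      \<forall>\<theta>\<in>\<Gamma>. (\<integral>\<^sup>+ X. ennreal ((norm (est X - \<theta>))\<^sup>2) \<partial>samples k \<theta>) \<le> ennreal ((sqrt 2 * \<epsilon>)\<^sup>2))"
    using k(2) unfolding n_est_def by (rule not_less_Least)
  ultimately obtain \<theta> where \<theta>: "\<theta> \<in> \<Gamma>"
    "\<not> (\<integral>\<^sup>+ X. ennreal ((norm (est X - \<theta>))\<^sup>2) \<partial>samples k \<theta>) \<le> ennreal ((sqrt 2 * \<epsilon>)\<^sup>2)"
    by blast
  define S where "S = (\<Sum>i\<in>UNIV. min ((\<theta> $ i)\<^sup>2) (8 * L / k))"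
  have "ennreal ((sqrt 2 * \<epsilon>)\<^sup>2) < ennreal (3/2 * S + 3 / (2 * k * L))"
    using \<theta>(2) soft_threshold_risk[OF k(1), of \<theta>] unfolding est_def S_def L_def by (auto simp: not_le)
  hence "2 * \<epsilon>\<^sup>2 < 3/2 * S + 3 / (2 * k * L)"
    by (subst (asm) ennreal_less_iff) (auto simp: power_mult_distrib)
  \<comment> \<open>This is where \<open>kL\<close> enters: the noise term takes at most 1/2 of the
    2 \<open>\<epsilon>\<close>^2, leaving 3/2 for the term 3/2 * S.\<close>
  moreover have "3 / (2 * k * L) \<le> \<epsilon>\<^sup>2 / 2"
    using kL k L by (simp add: field_simps)
  ultimately have S: "S > \<epsilon>\<^sup>2" by linarith
  hence S0: "S > 0" using zero_le_power2[of \<epsilon>] by linarith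
  define t where "t = \<epsilon> / sqrt S"
  have "\<epsilon> \<le> sqrt S" using S by (intro real_le_rsqrt) simp
  hence t: "0 \<le> t" "t \<le> 1" "t\<^sup>2 * S = \<epsilon>\<^sup>2" using S0 \<epsilon> by (auto simp: t_def power_divide)
  hence t2: "t\<^sup>2 \<le> 1" by (simp add: power_le_one)
  \<comment> \<open>The coordinates of \<open>\<theta>\<close> are truncated at the root of 8 L / k,
    stripped of their signs, and scaled by t to norm \<open>\<epsilon>\<close>; solidity keeps x in
    \<open>\<Gamma>\<close>.\<close>
  define x where "x = (\<chi> i. t * sqrt (min ((\<theta> $ i)\<^sup>2) (8 * L / k)))"
  have mn: "min ((\<theta> $ i)\<^sup>2) (8 * L / k) \<ge> 0" for i using L by simp
  have xi: "(x $ i)\<^sup>2 = t\<^sup>2 * min ((\<theta> $ i)\<^sup>2) (8 * L / k)" for i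
    using mn[of i] by (simp add: x_def power_mult_distrib)
  have le: "(x $ i)\<^sup>2 \<le> min ((\<theta> $ i)\<^sup>2) (8 * L / k)" for i
    unfolding xi using mn t2 by (intro mult_left_le_one_le) auto
  have "x \<in> \<Gamma>"
  proof (rule orthosymmetric_convex_solid[OF \<Gamma> \<theta>(1)])
    fix i
    show "\<bar>x $ i\<bar> \<le> \<bar>\<theta> $ i\<bar>" using le[of i] by (simp add: abs_le_square_iff)
  qed
  moreover have "(norm x)\<^sup>2 = \<epsilon>\<^sup>2"
    unfolding norm_square_vec xi sum_distrib_left[symmetric] S_def[symmetric] by (rule t(3))
  hence "norm x = \<epsilon>" using \<epsilon> by (simp add: power2_eq_iff_nonneg)
  ultimately show ?thesis using le by auto
qed

section \<open>Assembling the three bounds\<close>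

theorem mainTheorem6:
  fixes \<Gamma> :: "(real^'d) set" and \<epsilon> :: real and m n :: nat
  assumes "orthosymmetric \<Gamma>" and "compact \<Gamma>" and "convex \<Gamma>"
    and "\<epsilon> > 0"
    and "\<exists>\<theta>1\<in>\<Gamma>. \<exists>\<theta>2\<in>\<Gamma>. dist \<theta>1 \<theta>2 \<ge> \<epsilon>"
    and "m > 0" and "n > 0"
    and "lfht_feasible \<Gamma> \<epsilon> m n"
  shows "real m \<ge> 1 / \<epsilon>\<^sup>2
    \<and> real n \<ge> sqrt (real (n_est \<Gamma> (sqrt 2 * \<epsilon>)))
                 / (8 * \<epsilon> * sqrt (ln (4 * real CARD('d))))
    \<and> real m * real n \<ge> (real (n_est \<Gamma> (sqrt 2 * \<epsilon>)) - 1)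
                 / (3072 * \<epsilon>\<^sup>2 * ln (4 * real CARD('d)))"
proof -
  define N where "N = n_est \<Gamma> (sqrt 2 * \<epsilon>)"
  define L where "L = ln (4 * real CARD('d))"
  note \<epsilon> = \<open>\<epsilon> > 0\<close>
  have mb: "real m * \<epsilon>\<^sup>2 \<ge> 1" and nb: "real n * \<epsilon>\<^sup>2 \<ge> 1/2"
    using two_point_bounds assms by blast+
  have "exp 1 \<le> 4 * real CARD('d)"
    using exp_le zero_less_card_finite[where 'a='d] by linarith
  hence L: "L \<ge> 1" unfolding L_def by (subst ln_ge_iff) auto
  have n1: "real n \<ge> 1" using assms by simp
  have *: "real N \<le> 64 * (real n)\<^sup>2 * \<epsilon>\<^sup>2 * L \<and> real N - 1 \<le> 3072 * (real m * real n) * \<epsilon>\<^sup>2 * L"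
  proof (cases "N \<le> 1")
    case True
    \<comment> \<open>No positive k below \<open>N\<close> exists here, but the left-hand sides are
      at most 1 and 0.\<close>
    have "real n * (real n * \<epsilon>\<^sup>2) * L \<ge> 1 * (1/2) * 1"
      using n1 nb L by (intro mult_mono) auto
    moreover have "0 \<le> 3072 * (real m * real n) * \<epsilon>\<^sup>2 * L" using L by simp
    ultimately show ?thesis using True by (simp add: power2_eq_square mult_ac)
  next
    case False
    \<comment> \<open>The largest sample size that is insufficient by minimality of
      \<open>n_est\<close>.\<close>
    define k where "k = N - 1"
    have k: "k > 0" "k < N" "real N = real k + 1" using False by (auto simp: k_def)
    show ?thesis
    proof (cases "3 \<le> k * L * \<epsilon>\<^sup>2")
      case True
      from ex_spread_vector[OF assms(1,3) \<epsilon> k(1) _ True[unfolded L_def]] k(2)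
      obtain x where x: "x \<in> \<Gamma>" "norm x = \<epsilon>" "\<And>i. (x $ i)\<^sup>2 \<le> 8 * L / k"
        unfolding N_def L_def by blast
      from mixture_bounds[OF assms(1,3) \<epsilon> assms(8) x]
      \<comment> \<open>With c = 8 L / k the mixture bounds give k \<le> 20 n^2
        \<open>\<epsilon>\<close>^2 L and k \<le> 80 m n \<open>\<epsilon>\<close>^2 L; as N \<le> 2
        k, the constants 64 and 3072 leave room.\<close>
      have "k / 20 \<le> (real n)\<^sup>2 * \<epsilon>\<^sup>2 * L" "k / 80 \<le> real m * real n * \<epsilon>\<^sup>2 * L"
        using k(1) by (simp_all add: field_simps)
      moreover have "real k \<ge> 1" using k(1) by simp
      ultimately show ?thesis unfolding k(3) by (auto simp: mult.assoc)
    next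
      case False
      \<comment> \<open>For such small k the two-point bounds suffice: after multiplication by L
        \<open>\<epsilon>\<close>^2 the right-hand sides are at least 64/4 and 3072/2, while 2 k and
        k become less than 6 and 3.\<close>
      have P: "0 < L * \<epsilon>\<^sup>2" using L \<epsilon> by simp
      have LL: "L * L \<ge> 1" using mult_mono[OF L L] L by simp
      have kl: "real k * (L * \<epsilon>\<^sup>2) < 3" using False by (simp add: mult.assoc)
      have "(real n * \<epsilon>\<^sup>2) * (real n * \<epsilon>\<^sup>2) * (L * L) \<ge> 1/2 * (1/2) * 1"
        using nb LL by (intro mult_mono) auto
      hence "2 * real k * (L * \<epsilon>\<^sup>2) \<le> (64 * (real n)\<^sup>2 * \<epsilon>\<^sup>2 * L) * (L * \<epsilon>\<^sup>2)"
        using kl by (simp add: power2_eq_square mult_ac)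
      hence "2 * real k \<le> 64 * (real n)\<^sup>2 * \<epsilon>\<^sup>2 * L"
        using P by (rule mult_right_le_imp_le)
      moreover have "(real m * \<epsilon>\<^sup>2) * (real n * \<epsilon>\<^sup>2) * (L * L) \<ge> 1 * (1/2) * 1"
        using mb nb LL by (intro mult_mono) auto
      hence "real k * (L * \<epsilon>\<^sup>2) \<le> (3072 * (real m * real n) * \<epsilon>\<^sup>2 * L) * (L * \<epsilon>\<^sup>2)"
        using kl by (simp add: power2_eq_square mult_ac)
      hence "real k \<le> 3072 * (real m * real n) * \<epsilon>\<^sup>2 * L"
        using P by (rule mult_right_le_imp_le)
      moreover have "real k \<ge> 1" using k(1) by simp
      ultimately show ?thesis unfolding k(3) by linarith
    qed
  qed
  have "sqrt (real N) \<le> sqrt ((8 * real n * \<epsilon>)\<^sup>2 * L)"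
    using * by (intro real_sqrt_le_mono) (simp add: power_mult_distrib)
  also have "\<dots> = 8 * real n * \<epsilon> * sqrt L"
    using \<epsilon> by (simp add: real_sqrt_mult)
  finally have 2: "sqrt (real N) / (8 * \<epsilon> * sqrt L) \<le> real n"
    using \<epsilon> L by (simp add: field_simps)
  have 3: "(real N - 1) / (3072 * \<epsilon>\<^sup>2 * L) \<le> real m * real n"
    using * \<epsilon> L by (simp add: field_simps)
  have "1 / \<epsilon>\<^sup>2 \<le> real m" using mb \<epsilon> by (simp add: field_simps)
  with 2 3 show ?thesis unfolding N_def L_def by blast
qed

end
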